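(* Let $n\geq 1$, $I=[0,1]$, let $\{S_\lambda(t)\}_{(\lambda,t)\in I\times I}$ be a continuous family of real symmetric $2n\times 2n$ matrices, and let $\Lambda_1,\Lambda_2$ be continuous paths, parametrised by $\lambda\in I$, of Lagrangian subspaces of $\mathbb{R}^{2n}$. For $\lambda\in I$ consider the boundary value problem $$(\ast)_\lambda\qquad \begin{cases} Ju'(t)+S_\lambda(t)u(t)=0,\quad t\in I,\\ u(0)\in\Lambda_1(\lambda),\quad u(1)\in\Lambda_2(\lambda),\end{cases}\qquad J=\begin{pmatrix}0&-I_n\\ I_n&0\end{pmatrix}.$$ If either (i) $\mu_{Mas}(\Lambda_1,\Lambda_2)>0$, $S_0\leq 0$ and $S_1\geq 0$, or (ii) $\mu_{Mas}(\Lambda_1,\Lambda_2)<0$, $S_0\geq 0$ and $S_1\leq 0$, then there are at least $$\left\lceil\frac{|\mu_{Mas}(\Lambda_1,\Lambda_2)|}{n}\right\rceil$$ parameter values $\lambda\in I$ for which $(\ast)_\lambda$ has a non-trivial solution.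
   Context: A subspace $L\subset\mathbb{R}^{2n}$ is Lagrangian if $JL=L^\perp$ (orthogonal complement for the standard scalar product). The set $\Lambda(n)$ of Lagrangian subspaces carries the topology induced from the Grassmannian $G_n(\mathbb{R}^{2n})$. One writes $S_\lambda\geq 0$ (resp. $S_\lambda\leq 0$) if $\langle S_\lambda(t)u,u\rangle\geq 0$ (resp. $\leq 0$) for all $u\in\mathbb{R}^{2n}$ and all $t\in I$. Maslov index $\mu_{Mas}(\Lambda_1,\Lambda_2)\in\mathbb{Z}$ of a pair of continuous paths $(\Lambda_1,\Lambda_2):I\to\Lambda(n)\times\Lambda(n)$ (the Cappell--Lee--Miller index): it is the count, with signs, of non-trivial intersections of $\Lambda_1(\lambda)$ and $\Lambda_2(\lambda)$ along $I$. Explicitly, choose a partition $0=\lambda_0<\dots<\lambda_N=1$ and numbers $a_i\in(0,\frac{\pi}{2})$ such that $e^{-\theta J}\Lambda_1(\lambda)\cap\Lambda_2(\lambda)=\{0\}$ for $\theta=\pm a_i$ and all $\lambda\in[\lambda_{i-1},\lambda_i]$; then $$\mu_{Mas}(\Lambda_1,\Lambda_2)=\sum_{i=1}^N\bigl(k(\lambda_i,a_i)-k(\lambda_{i-1},a_i)\bigr),\qquad k(\lambda,a)=\sum_{0\leq\theta\leq a}\dim\bigl(e^{-\theta J}\Lambda_1(\lambda)\cap\Lambda_2(\lambda)\bigr),$$ which is independent of the choices. The sign and endpoint conventions are such that $\mu_{Mas}(\Lambda_1,\Lambda_2)$ is the spectral flow (the net number of eigenvalues that cross from negative to non-negative values as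 $\lambda$ goes from $0$ to $1$) of the path of selfadjoint operators $u\mapsto Ju'$ on $L^2(I,\mathbb{R}^{2n})$ with domains $\{u\in H^1(I,\mathbb{R}^{2n}):u(0)\in\Lambda_1(\lambda),\ u(1)\in\Lambda_2(\lambda)\}$. *)

theory Defs
  imports "HOL-Analysis.Analysis"
begin

text \<open>
  The space of real \<open>2n\<close>-vectors is \<open>real ^ ('n + 'n)\<close> with \<open>n = CARD('n)\<close>: the \<open>Inl\<close>
  coordinates are the first \<open>n\<close>, the \<open>Inr\<close> coordinates the last \<open>n\<close>. Paths are total
  functions on the reals of which only the values on \<open>{0..1}\<close> are ever used.
\<close>

subsection \<open>Symplectic matrix and Lagrangian subspaces\<close>

definition J_mat :: "real ^ ('n::finite + 'n) ^ ('n + 'n)" where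
  "J_mat = (\<chi> i j. case (i, j) of
      (Inl a, Inr b) \<Rightarrow> (if a = b then -1 else 0)
    | (Inr a, Inl b) \<Rightarrow> (if a = b then 1 else 0)
    | _ \<Rightarrow> 0)"

definition lagrangian :: "(real ^ ('n::finite + 'n)) set \<Rightarrow> bool" where
  "lagrangian L \<longleftrightarrow> subspace L \<and> (\<lambda>x. J_mat *v x) ` L = L\<^sup>\<bottom>"

text \<open>
  On a subspace, the nearest-point map \<^const>\<open>closest_point\<close> is the orthogonal projection
  (see \<open>closest_point_subspace\<close> below). The Grassmannian has the topology of the
  metric \<open>d(L, M) = \<parallel>P\<^sub>L - P\<^sub>M\<parallel>\<close>, which is the one making \<open>L \<mapsto> P\<^sub>L\<close> an embedding into the
  matrices.
\<close>

definition orth_projector :: "(real ^ 'm::finite) set \<Rightarrow> real ^ 'm ^ 'm" where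
  "orth_projector L = matrix (closest_point L)"

definition grassmannian :: "nat \<Rightarrow> (real ^ 'm::finite) set set" where
  "grassmannian k = {L. subspace L \<and> dim L = k}"

definition grassmann_topology :: "nat \<Rightarrow> (real ^ 'm::finite) set topology" where
  "grassmann_topology k = pullback_topology (grassmannian k) orth_projector euclidean"

definition lagrangian_topology :: "(real ^ ('n::finite + 'n)) set topology" where
  "lagrangian_topology = subtopology (grassmann_topology CARD('n)) (Collect lagrangian)"

definition lagrangian_path :: "(real \<Rightarrow> (real ^ ('n::finite + 'n)) set) \<Rightarrow> bool" where
  "lagrangian_path L \<longleftrightarrow> continuous_map (top_of_set {0..1}) lagrangian_topology L"

subsection \<open>Maslov index\<close>

text \<open>The iterate is the \<open>k\<close>-th power of \<open>A\<close> for the matrix product; the operator \<open>^\<close> on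
  vectors would be taken componentwise.\<close>

definition mat_exp :: "real ^ 'm::finite ^ 'm \<Rightarrow> real ^ 'm ^ 'm" where
  "mat_exp A = (\<Sum>k. (1 / fact k) *\<^sub>R (((**) A) ^^ k) (mat 1))"

text \<open>The space \<open>e\<^bsup>-\<theta>J\<^esup> L \<inter> M\<close>.\<close>

definition rot_inter ::
  "(real ^ ('n::finite + 'n)) set \<Rightarrow> (real ^ ('n + 'n)) set \<Rightarrow> real \<Rightarrow> (real ^ ('n + 'n)) set" where
  "rot_inter L M \<theta> = (\<lambda>x. mat_exp ((- \<theta>) *\<^sub>R J_mat) *v x) ` L \<inter> M"

text \<open>
  For Lagrangian \<open>L\<close>, \<open>M\<close> only finitely many \<open>\<theta> \<in> [0, a]\<close> give a nontrivial intersection. The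
  restriction to those is needed because \<^const>\<open>sum\<close> over an infinite index set is \<open>0\<close>.
\<close>

definition maslov_count ::
  "(real ^ ('n::finite + 'n)) set \<Rightarrow> (real ^ ('n + 'n)) set \<Rightarrow> real \<Rightarrow> nat" where
  "maslov_count L M a =
     (\<Sum>\<theta> | 0 \<le> \<theta> \<and> \<theta> \<le> a \<and> rot_inter L M \<theta> \<noteq> {0}. dim (rot_inter L M \<theta>))"

definition maslov_partition ::
  "(real \<Rightarrow> (real ^ ('n::finite + 'n)) set) \<Rightarrow> (real \<Rightarrow> (real ^ ('n + 'n)) set) \<Rightarrow>
   nat \<Rightarrow> (nat \<Rightarrow> real) \<Rightarrow> (nat \<Rightarrow> real) \<Rightarrow> bool" where
  "maslov_partition L1 L2 N p a \<longleftrightarrow>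
     p 0 = 0 \<and> p N = 1 \<and> (\<forall>i\<in>{1..N}. p (i - 1) < p i) \<and>
     (\<forall>i\<in>{1..N}. 0 < a i \<and> a i < pi / 2 \<and>
        (\<forall>l\<in>{p (i - 1)..p i}.
           rot_inter (L1 l) (L2 l) (a i) = {0} \<and> rot_inter (L1 l) (L2 l) (- a i) = {0}))"

definition maslov_sum ::
  "(real \<Rightarrow> (real ^ ('n::finite + 'n)) set) \<Rightarrow> (real \<Rightarrow> (real ^ ('n + 'n)) set) \<Rightarrow>
   nat \<Rightarrow> (nat \<Rightarrow> real) \<Rightarrow> (nat \<Rightarrow> real) \<Rightarrow> int" where
  "maslov_sum L1 L2 N p a =
     (\<Sum>i=1..N. int (maslov_count (L1 (p i)) (L2 (p i)) (a i))
              - int (maslov_count (L1 (p (i - 1))) (L2 (p (i - 1))) (a i)))"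

text \<open>For continuous paths of Lagrangian subspaces a partition exists and the sum does not depend
  on the choices, so the description is proper there.\<close>

definition maslov_index ::
  "(real \<Rightarrow> (real ^ ('n::finite + 'n)) set) \<Rightarrow> (real \<Rightarrow> (real ^ ('n + 'n)) set) \<Rightarrow> int" where
  "maslov_index L1 L2 =
     (THE m. \<exists>N p a. maslov_partition L1 L2 N p a \<and> m = maslov_sum L1 L2 N p a)"

subsection \<open>The boundary value problem\<close>

text \<open>Solutions are classical. As \<open>J\<close> is invertible, a solution is automatically \<open>C\<^sup>1\<close> when \<open>A\<close>
  is continuous. At \<open>0\<close> and \<open>1\<close> the derivatives are one-sided.\<close>

definition bvp_solution ::
  "(real \<Rightarrow> real ^ ('n::finite + 'n) ^ ('n + 'n)) \<Rightarrow>
   (real ^ ('n + 'n)) set \<Rightarrow> (real ^ ('n + 'n)) set \<Rightarrow> (real \<Rightarrow> real ^ ('n + 'n)) \<Rightarrow> bool" where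
  "bvp_solution A L M u \<longleftrightarrow>
     (\<exists>u'. \<forall>t\<in>{0..1}. (u has_vector_derivative u' t) (at t within {0..1}) \<and>
                      J_mat *v u' t + A t *v u t = 0) \<and>
     u 0 \<in> L \<and> u 1 \<in> M"

definition has_nontrivial_solution ::
  "(real \<Rightarrow> real ^ ('n::finite + 'n) ^ ('n + 'n)) \<Rightarrow>
   (real ^ ('n + 'n)) set \<Rightarrow> (real ^ ('n + 'n)) set \<Rightarrow> bool" where
  "has_nontrivial_solution A L M \<longleftrightarrow> (\<exists>u. bvp_solution A L M u \<and> (\<exists>t\<in>{0..1}. u t \<noteq> 0))"

definition nonneg_family :: "(real \<Rightarrow> real ^ 'm::finite ^ 'm) \<Rightarrow> bool" where
  "nonneg_family A \<longleftrightarrow> (\<forall>t\<in>{0..1}. \<forall>u. 0 \<le> (A t *v u) \<bullet> u)"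

definition nonpos_family :: "(real \<Rightarrow> real ^ 'm::finite ^ 'm) \<Rightarrow> bool" where
  "nonpos_family A \<longleftrightarrow> (\<forall>t\<in>{0..1}. \<forall>u. (A t *v u) \<bullet> u \<le> 0)"

subsection \<open>Consistency of the definitions\<close>

lemma closest_point_subspace:
  fixes L :: "(real ^ 'm::finite) set"
  assumes "subspace L"
  shows "closest_point L x \<in> L" and "x - closest_point L x \<in> L\<^sup>\<bottom>"
proof -
  have L: "closed L" "convex L" "L \<noteq> {}"
    using assms closed_subspace subspace_imp_convex subspace_0 by blast+
  show in_L: "closest_point L x \<in> L"
    using L closest_point_in_set by blast
  have le: "(x - closest_point L x) \<bullet> y \<le> 0" if "y \<in> L" for y
    using closest_point_dot[OF L(2,1), of "closest_point L x + y" x] that in_L assms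
    by (simp add: subspace_add)
  have "(x - closest_point L x) \<bullet> y = 0" if "y \<in> L" for y
    using le[OF that] le[of "- y"] that assms by (simp add: subspace_neg)
  then show "x - closest_point L x \<in> L\<^sup>\<bottom>"
    by (simp add: orthogonal_comp_def orthogonal_def inner_commute)
qed

lemma J_mat_square: "J_mat ** J_mat = - (mat 1 :: real ^ ('n::finite + 'n) ^ ('n + 'n))"
proof -
  have split: "sum f (UNIV :: ('n + 'n) set) = (\<Sum>a\<in>UNIV. f (Inl a)) + (\<Sum>b\<in>UNIV. f (Inr b))"
    for f :: "'n + 'n \<Rightarrow> real"
    by (simp add: sum.Plus comp_def flip: UNIV_Plus_UNIV)
  have delta: "(\<Sum>k\<in>UNIV. (if a = k then c else 0) * (if k = b then d else 0)) = (if a = b then c * d else 0)"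
    for a b :: 'n and c d :: real
  proof -
    have "(\<Sum>k\<in>UNIV. (if a = k then c else 0) * (if k = b then d else 0)) =
        (\<Sum>k\<in>UNIV. if k = a then (if a = b then c * d else 0) else 0)"
      by (rule sum.cong) auto
    then show ?thesis by simp
  qed
  have "(J_mat ** J_mat) $ i $ j = (- (mat 1 :: real ^ ('n + 'n) ^ ('n + 'n))) $ i $ j" for i j
    by (cases i; cases j) (simp_all add: matrix_matrix_mult_def J_mat_def mat_def split delta)
  then show ?thesis
    by (simp add: vec_eq_iff)
qed

lemma mat_exp_J:
  "mat_exp (\<theta> *\<^sub>R J_mat) = cos \<theta> *\<^sub>R mat 1 + sin \<theta> *\<^sub>R (J_mat :: real ^ ('n::finite + 'n) ^ ('n + 'n))"
proof -
  let ?J = "J_mat :: real ^ ('n + 'n) ^ ('n + 'n)"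
  let ?c = "\<lambda>k. if even k then (-1) ^ (k div 2) else 0 :: real"
  let ?s = "\<lambda>k. if even k then 0 else (-1) ^ ((k - Suc 0) div 2) :: real"
  have scal: "(a *\<^sub>R ?J) ** B = a *\<^sub>R (?J ** B)" "?J ** (a *\<^sub>R B) = a *\<^sub>R (?J ** B)"
    for a and B :: "real ^ ('n + 'n) ^ ('n + 'n)"
    by (simp_all add: matrix_matrix_mult_def vec_eq_iff sum_distrib_left mult_ac)
  have pow: "(((**) (\<theta> *\<^sub>R ?J)) ^^ k) (mat 1) = \<theta> ^ k *\<^sub>R (?c k *\<^sub>R mat 1 + ?s k *\<^sub>R ?J)" for k
  proof (induction k)
    case 0
    show ?case by simp
  next
    case (Suc k)
    have "(((**) (\<theta> *\<^sub>R ?J)) ^^ Suc k) (mat 1) = (\<theta> *\<^sub>R ?J) ** (\<theta> ^ k *\<^sub>R (?c k *\<^sub>R mat 1 + ?s k *\<^sub>R ?J))"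
      by (simp only: funpow.simps o_apply Suc.IH)
    also have "\<dots> = \<theta> ^ Suc k *\<^sub>R (?c k *\<^sub>R ?J + ?s k *\<^sub>R (- mat 1))"
      by (simp only: scal matrix_add_ldistrib J_mat_square matrix_mul_rid scaleR_scaleR power_Suc)
    also have "?c k *\<^sub>R ?J + ?s k *\<^sub>R (- mat 1) = ?c (Suc k) *\<^sub>R mat 1 + ?s (Suc k) *\<^sub>R ?J"
      by (cases "even k") (auto elim!: oddE)
    finally show ?case .
  qed
  have eq: "(1 / fact k) *\<^sub>R (((**) (\<theta> *\<^sub>R ?J)) ^^ k) (mat 1) =
      (cos_coeff k *\<^sub>R \<theta> ^ k) *\<^sub>R mat 1 + (sin_coeff k *\<^sub>R \<theta> ^ k) *\<^sub>R ?J" for k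
    unfolding pow by (simp add: cos_coeff_def sin_coeff_def)
  have "(\<lambda>k. (cos_coeff k *\<^sub>R \<theta> ^ k) *\<^sub>R (mat 1 :: real ^ ('n + 'n) ^ ('n + 'n))
          + (sin_coeff k *\<^sub>R \<theta> ^ k) *\<^sub>R ?J) sums (cos \<theta> *\<^sub>R mat 1 + sin \<theta> *\<^sub>R ?J)"
    by (intro sums_add sums_scaleR_left cos_converges sin_converges)
  then show ?thesis
    unfolding mat_exp_def eq by (rule sums_unique[symmetric])
qed

end

theory Submission
  imports Defs
begin

text \<open>
  The counts \<open>k(x, a)\<close> of a continuous family of Lagrangian pairs over a compact convex set of
  parameters have differences \<open>k(x, b) - k(x, a)\<close> that are locally constant wherever \<open>a\<close> and \<open>b\<close>
  are not relative angles. Hence there is an integer function \<open>N\<close> such that \<open>N(x) - k(x, a)\<close> is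
  locally constant wherever \<open>a\<close> is not a relative angle, and the Maslov index along a path is the
  difference of the values of \<open>N\<close> at its end points.

  Let \<open>\<Psi>\<^sub>l(t)\<close> be the fundamental solution of \<open>u' = J S\<^sub>l u\<close>, and apply this to the pairs
  \<open>(\<Psi>\<^sub>l(t) L\<^sub>1(l), L\<^sub>2(l))\<close>. On the side \<open>t = 0\<close> of the square the increment of \<open>N\<close> is the given
  Maslov index. On the sides \<open>l = 0\<close> and \<open>l = 1\<close> the sign of \<open>S\<^sub>l\<close> makes \<open>N\<close> monotone in \<open>t\<close>, so the
  increment on the side \<open>t = 1\<close> has the same sign and is at least as large in absolute value. There
  \<open>N\<close> jumps only at those \<open>l\<close> for which the boundary value problem has a non-trivial solution, and
  by at most \<open>n\<close>.
\<close>

text \<open>Relative angles are never chosen continuously. Every pair has an orthonormal basis of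
  its first space made of angle vectors, with angles defined modulo \<open>pi\<close>; such bases
  are bounded, so statements about nearby parameters come from convergent subsequences of them. An
  angle passing 0 changes the counts for all admissible \<open>a\<close> alike, which is why their
  differences are locally constant and why \<open>N\<close> registers the passages through 0.
  Convexity replaces a homotopy argument: locally consistent increments have a global primitive
  there, and sides of the square are compared by subtracting corner values. The signs of the
  matrices are only semidefinite, so crossings along \<open>t\<close> may be degenerate. A third
  coordinate, a small rotation, makes the paths strictly positive. That it can be removed again
  rests on the convention that an angle equal to 0 is counted.\<close>

section \<open>The complex structure and its rotations\<close>

abbreviation J :: "real ^ ('n::finite + 'n) \<Rightarrow> real ^ ('n + 'n)" where
  "J v \<equiv> J_mat *v v"

definition rot :: "real \<Rightarrow> real ^ ('n::finite + 'n) \<Rightarrow> real ^ ('n + 'n)" where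
  "rot t v = cos t *\<^sub>R v + sin t *\<^sub>R J v"

lemma J_J [simp]: "J (J v) = - v"
proof -
  have "J (J v) = (- mat 1) *v v"
    by (simp add: matrix_vector_mul_assoc J_mat_square)
  also have "\<dots> = - (mat 1 *v v)"
    by (simp add: matrix_vector_mult_def vec_eq_iff sum_negf)
  finally show ?thesis by simp
qed

lemma J_transpose: "transpose J_mat = - (J_mat :: real ^ ('n::finite + 'n) ^ ('n + 'n))"
proof -
  have "transpose J_mat $ i $ j = - (J_mat :: real ^ ('n + 'n) ^ ('n + 'n)) $ i $ j" for i j
    by (cases i; cases j) (simp_all add: transpose_def J_mat_def)
  then show ?thesis
    by (simp add: vec_eq_iff)
qed

lemma J_inner_left: "J u \<bullet> v = - (u \<bullet> J v)"
proof -
  have "J u \<bullet> v = u \<bullet> (transpose J_mat *v v)"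
    by (metis dot_lmul_matrix transpose_transpose vector_transpose_matrix)
  also have "transpose J_mat *v v = - J v"
    unfolding J_transpose by (simp add: matrix_vector_mult_def vec_eq_iff sum_negf)
  finally show ?thesis by simp
qed

lemma J_linear_simps [simp]:
  "J (u + v) = J u + J v" "J (u - v) = J u - J v" "J (c *\<^sub>R v) = c *\<^sub>R J v" "J 0 = 0" "J (- v) = - J v"
proof -
  note lin = matrix_vector_mul_linear[of J_mat]
  show "J (u + v) = J u + J v" "J (u - v) = J u - J v" "J (c *\<^sub>R v) = c *\<^sub>R J v" "J 0 = 0" "J (- v) = - J v"
    by (simp_all only: linear_add[OF lin] linear_diff[OF lin] linear_cmul[OF lin] linear_0[OF lin]
          linear_neg[OF lin])
qed

lemma J_isometry [simp]: "J u \<bullet> J v = u \<bullet> v"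
  by (simp add: J_inner_left)

lemma J_skew [simp]: "J u \<bullet> u = 0" "u \<bullet> J u = 0"
  using J_inner_left[of u u] by (simp_all add: inner_commute)

lemma linear_rot: "linear (rot t)"
  by (rule linearI) (simp_all add: rot_def algebra_simps)

lemma rot_linear_simps [simp]:
  "rot t (u + v) = rot t u + rot t v" "rot t (u - v) = rot t u - rot t v"
  "rot t (c *\<^sub>R v) = c *\<^sub>R rot t v" "rot t 0 = 0" "rot t (- v) = - rot t v"
  by (simp_all only: linear_add[OF linear_rot] linear_diff[OF linear_rot] linear_cmul[OF linear_rot]
        linear_0[OF linear_rot] linear_neg[OF linear_rot])

lemma rot_0 [simp]: "rot 0 v = v"
  by (simp add: rot_def)

lemma rot_rot [simp]: "rot s (rot t v) = rot (s + t) v"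
  by (simp add: rot_def cos_add sin_add algebra_simps)

lemma rot_pi: "rot (t + pi) v = - rot t v"
  by (simp add: rot_def)

lemma J_rot: "J (rot t v) = rot t (J v)"
  by (simp add: rot_def)

lemma rot_isometry [simp]: "rot t u \<bullet> rot t v = u \<bullet> v"
proof -
  have "rot t u \<bullet> rot t v = ((cos t)\<^sup>2 + (sin t)\<^sup>2) * (u \<bullet> v)"
    by (simp add: rot_def inner_add_left inner_add_right J_inner_left power2_eq_square algebra_simps
             del: sin_cos_squared_add sin_cos_squared_add2 sin_cos_squared_add3)
  then show ?thesis by (simp only: sin_cos_squared_add2 mult_1_left)
qed

lemma inner_rot_left: "rot t u \<bullet> v = u \<bullet> rot (- t) v"
  using rot_isometry[of "t" u "rot (- t) v"] by simp

lemma mat_exp_J_eq_rot: "mat_exp (t *\<^sub>R J_mat) *v v = rot t v"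
  by (simp add: mat_exp_J rot_def matrix_vector_mult_add_rdistrib flip: scaleR_matrix_vector_assoc)

lemma tendsto_J [tendsto_intros]: "(f \<longlongrightarrow> l) F \<Longrightarrow> ((\<lambda>x. J (f x)) \<longlongrightarrow> J l) F"
  by (rule bounded_linear.tendsto[OF matrix_vector_mul_bounded_linear])

lemma tendsto_rot [tendsto_intros]:
  "(t \<longlongrightarrow> t') F \<Longrightarrow> (f \<longlongrightarrow> l) F \<Longrightarrow> ((\<lambda>x. rot (t x) (f x)) \<longlongrightarrow> rot t' l) F"
  unfolding rot_def
  by (intro tendsto_add tendsto_scaleR tendsto_J isCont_tendsto_compose[OF isCont_cos]
      isCont_tendsto_compose[OF isCont_sin])

subsection \<open>Lagrangian subspaces\<close>

lemma lagrangian_subspace: "lagrangian L \<Longrightarrow> subspace L"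
  by (simp add: lagrangian_def)

lemma lagrangian_isotropic:
  assumes "lagrangian L" "u \<in> L" "v \<in> L"
  shows "J u \<bullet> v = 0"
proof -
  have "J u \<in> L\<^sup>\<bottom>" using assms by (auto simp: lagrangian_def)
  then show ?thesis using assms(3) by (simp add: orthogonal_comp_def orthogonal_def inner_commute)
qed

text \<open>A Lagrangian subspace is its own symplectic complement, because \<open>J\<close> carries
  the orthogonal complement back to \<open>L\<close>. Membership in a Lagrangian subspace is
  established through this fact.\<close>

lemma lagrangian_maximal:
  assumes "lagrangian L" and "\<And>v. v \<in> L \<Longrightarrow> w \<bullet> v = 0"
  shows "J w \<in> L"
proof -
  have "w \<in> L\<^sup>\<bottom>"
    using assms(2) by (simp add: orthogonal_comp_def orthogonal_def inner_commute)
  then obtain z where "z \<in> L" "w = J z"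
    using assms(1) by (auto simp: lagrangian_def)
  then show ?thesis
    using assms(1) by (simp add: lagrangian_def subspace_neg)
qed

lemma lagrangianI:
  assumes "subspace L" and "\<And>u v. u \<in> L \<Longrightarrow> v \<in> L \<Longrightarrow> J u \<bullet> v = 0"
    and "\<And>w. (\<And>v. v \<in> L \<Longrightarrow> w \<bullet> v = 0) \<Longrightarrow> J w \<in> L"
  shows "lagrangian L"
  unfolding lagrangian_def
proof (intro conjI set_eqI iffI)
  fix w assume "w \<in> L\<^sup>\<bottom>"
  then have "J w \<in> L"
    using assms(3)[of w] by (simp add: orthogonal_comp_def orthogonal_def inner_commute)
  then have "- J w \<in> L" using assms(1) subspace_neg by blast
  moreover have "w = J (- J w)" by simp
  ultimately show "w \<in> J ` L" by blast
next
  fix w assume "w \<in> J ` L"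
  then show "w \<in> L\<^sup>\<bottom>"
    using assms(2) by (auto simp: orthogonal_comp_def orthogonal_def inner_commute)
qed (rule assms(1))

lemma dim_lagrangian:
  fixes L :: "(real ^ ('n::finite + 'n)) set"
  assumes "lagrangian L"
  shows "dim L = CARD('n)"
proof -
  have L: "subspace L" "J ` L = L\<^sup>\<bottom>" using assms by (simp_all add: lagrangian_def)
  have "inj J"
    by (rule injI) (metis J_J neg_equal_iff_equal)
  then have "dim (L\<^sup>\<bottom>) = dim L"
    using dim_image_eq[of "J :: real ^ ('n + 'n) \<Rightarrow> _" L] inj_on_subset[OF \<open>inj J\<close>] L(2)
    by (metis matrix_vector_mul_linear subset_UNIV)
  moreover have "dim {y. y \<in> UNIV \<and> (\<forall>x\<in>L. orthogonal x y)} + dim L = dim (UNIV :: (real ^ ('n + 'n)) set)"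
    by (rule dim_subspace_orthogonal_to_vectors) (use L in auto)
  moreover have "{y. y \<in> UNIV \<and> (\<forall>x\<in>L. orthogonal x y)} = L\<^sup>\<bottom>"
    by (auto simp: orthogonal_comp_def)
  ultimately show ?thesis by simp
qed

subsection \<open>Relative angles of two Lagrangian subspaces\<close>

text \<open>The intersection of the rotated \<open>L\<close> with \<open>M\<close>, pulled back into
  \<open>L\<close>: for all angles these spaces lie in one space of dimension \<open>n\<close> and
  can be compared there.\<close>

definition angle_space ::
  "(real ^ ('n::finite + 'n)) set \<Rightarrow> (real ^ ('n + 'n)) set \<Rightarrow> real \<Rightarrow> (real ^ ('n + 'n)) set" where
  "angle_space L M t = {u \<in> L. rot (- t) u \<in> M}"

text \<open>An orthonormal basis of \<open>L\<close> adapted to the pair. Storing basis and angles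
  as vectors over \<open>'n\<close> places frames in a finite-dimensional space, where bounded
  sequences have convergent subsequences.\<close>

definition angle_frame ::
  "(real ^ ('n::finite + 'n)) set \<Rightarrow> (real ^ ('n + 'n)) set \<Rightarrow>
   (real ^ ('n + 'n)) ^ 'n \<Rightarrow> real ^ 'n \<Rightarrow> bool" where
  "angle_frame L M u \<theta> \<longleftrightarrow>
     (\<forall>i j. u $ i \<bullet> u $ j = (if i = j then 1 else 0)) \<and> (\<forall>i. u $ i \<in> angle_space L M (\<theta> $ i))"

lemma rot_inter_eq: "rot_inter L M t = rot (- t) ` angle_space L M t"
  unfolding rot_inter_def mat_exp_J_eq_rot angle_space_def by auto

lemma subspace_angle_space: "subspace L \<Longrightarrow> subspace M \<Longrightarrow> subspace (angle_space L M t)"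
  by (auto simp: subspace_def angle_space_def)

lemma inj_rot: "inj (rot t)"
  by (rule injI) (metis add.left_inverse rot_0 rot_rot)

lemma dim_rot_inter: "dim (rot_inter L M t) = dim (angle_space L M t)"
  unfolding rot_inter_eq by (rule dim_image_eq[OF linear_rot]) (meson inj_rot inj_on_subset subset_UNIV)

lemma rot_inter_trivial_iff: "rot_inter L M t = {0} \<longleftrightarrow> angle_space L M t = {0}"
proof -
  have "rot (- t) ` angle_space L M t = rot (- t) ` {0} \<longleftrightarrow> angle_space L M t = {0}"
    by (rule inj_image_eq_iff[OF inj_rot])
  then show ?thesis by (simp add: rot_inter_eq)
qed

lemma angle_space_pi: "subspace M \<Longrightarrow> angle_space L M (t + pi) = angle_space L M t"
proof -
  assume M: "subspace M"
  have "rot (- (t + pi)) u \<in> M \<longleftrightarrow> rot (- t) u \<in> M" for u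
  proof -
    have "rot (- t) u = - rot (- (t + pi)) u"
      by (simp flip: rot_pi)
    then show ?thesis
      by (metis M add.inverse_inverse subspace_neg)
  qed
  then show ?thesis by (simp add: angle_space_def)
qed

text \<open>The analogue of the orthogonality of eigenspaces. The symplectic form vanishes on
  \<open>L\<close> and on \<open>M\<close>; expanding it on the rotated vectors leaves only
  \<open>sin (s - t) * (u \<bullet> v)\<close>.\<close>

lemma angle_spaces_orthogonal:
  assumes "lagrangian L" "lagrangian M" "u \<in> angle_space L M s" "v \<in> angle_space L M t"
    and "sin (s - t) \<noteq> 0"
  shows "u \<bullet> v = 0"
proof -
  have uv: "J u \<bullet> v = 0"
    using assms by (auto simp: angle_space_def intro: lagrangian_isotropic)
  have "0 = J (rot (- s) u) \<bullet> rot (- t) v"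
    using assms lagrangian_isotropic[of M] by (simp add: angle_space_def)
  also have "\<dots> = J u \<bullet> rot (s - t) v"
    by (simp add: J_rot inner_rot_left)
  also have "\<dots> = sin (s - t) * (u \<bullet> v)"
    by (simp add: rot_def inner_add_right uv)
  finally show ?thesis using assms(5) by simp
qed

lemma angle_space_int_pi:
  assumes "subspace M"
  shows "angle_space L M (t + of_int k * pi) = angle_space L M t"
proof (induction k rule: int_induct[where k = 0])
  case (step1 i)
  then show ?case
    using angle_space_pi[OF assms, of L "t + of_int i * pi"] by (simp add: algebra_simps)
next
  case (step2 i)
  then show ?case
    using angle_space_pi[OF assms, of L "t + of_int (i - 1) * pi"] by (simp add: algebra_simps)
qed simp

lemma angle_space_sin_eq_0:
  assumes "subspace M" "sin (s - t) = 0"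
  shows "angle_space L M s = angle_space L M t"
proof -
  obtain k :: int where "s - t = of_int k * pi"
    using assms(2) sin_zero_iff_int2 by blast
  then have "s = t + of_int k * pi" by simp
  then show ?thesis using angle_space_int_pi[OF assms(1)] by simp
qed

text \<open>The projection \<open>q\<close> of \<open>m\<close> onto \<open>H\<close> must be a
  multiple of \<open>u\<close>, since normalising \<open>q\<close> would otherwise give a larger
  inner product. The equality case of Cauchy-Schwarz takes the place of a Lagrange
  multiplier.\<close>

lemma sphere_maximizer_inner:
  fixes u m :: "'a::euclidean_space"
  assumes H: "subspace H" "u \<in> H" "norm u = 1"
    and max: "\<And>x. x \<in> H \<Longrightarrow> norm x = 1 \<Longrightarrow> x \<bullet> m \<le> u \<bullet> m"
    and x: "x \<in> H"
  shows "x \<bullet> m = (u \<bullet> m) * (x \<bullet> u)"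
proof -
  obtain q z where q: "q \<in> span H" and z: "\<And>w. w \<in> span H \<Longrightarrow> orthogonal z w" and m: "m = q + z"
    using orthogonal_subspace_decomp_exists[of H m] by blast
  have qH: "q \<in> H" using q H(1) by (metis span_eq_iff)
  have zz: "w \<bullet> m = w \<bullet> q" if "w \<in> H" for w
    using z[OF span_base[OF that]] by (simp add: m inner_add_right orthogonal_def inner_commute)
  have "q = (u \<bullet> m) *\<^sub>R u"
  proof (cases "q = 0")
    case False
    have "q \<bullet> q / norm q \<le> u \<bullet> q"
      using max[of "(1 / norm q) *\<^sub>R q"] zz[of "(1 / norm q) *\<^sub>R q"] zz[OF H(2)] False H(1) qH
      by (simp add: subspace_mul)
    then have "norm q \<le> u \<bullet> q"
      by (simp add: power2_norm_eq_inner[symmetric] power2_eq_square False)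
    then have eq: "u \<bullet> q = norm u * norm q"
      using norm_cauchy_schwarz[of u q] H(3) by simp
    then have "norm u *\<^sub>R q = norm q *\<^sub>R u"
      using norm_cauchy_schwarz_eq by blast
    then show ?thesis
      using eq zz[OF H(2)] H(3) by simp
  qed (use zz[OF H(2)] in simp)
  then show ?thesis using zz[OF x] by simp
qed

text \<open>A pair \<open>u\<close>, \<open>m\<close> of unit vectors maximising the inner product gives
  \<open>m = \<sigma> u + J v\<close> and \<open>(1 - \<sigma>\<^sup>2) J u + \<sigma> v \<in> M\<close> with \<open>v \<in> L\<close> of length \<open>\<rho> = \<surd>(1 - \<sigma>\<^sup>2)\<close>. Hence
  \<open>u + v / \<rho>\<close> lies in the angle space of the angle with cosine \<open>\<sigma>\<close> and sine \<open>- \<rho>\<close>, unless it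
  vanishes, in which case \<open>u\<close> itself lies in that of the opposite angle.\<close>

lemma angle_space_extension:
  fixes L M :: "(real ^ ('n::finite + 'n)) set"
  assumes L: "lagrangian L" and M: "lagrangian M" and "finite B" "card B < CARD('n)"
    and B: "\<And>b. b \<in> B \<Longrightarrow> b \<in> angle_space L M (t b)"
  shows "\<exists>a s. norm a = 1 \<and> (\<forall>b\<in>B. a \<bullet> b = 0) \<and> a \<in> angle_space L M s"
proof -
  \<comment> \<open>Rotating each \<open>b\<close> back by its angle gives a vector of
    \<open>M\<close>. The maximisation runs over the complements of \<open>B\<close> in
    \<open>L\<close> and of \<open>C\<close> in \<open>M\<close>, so that the vector built from the
    maximisers is orthogonal to \<open>B\<close>.\<close>
  define C where "C = (\<lambda>b. rot (- t b) b) ` B"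
  define L' where "L' = {x \<in> L. \<forall>b\<in>B. x \<bullet> b = 0}"
  define M' where "M' = {x \<in> M. \<forall>c\<in>C. x \<bullet> c = 0}"
  have sL: "subspace L" and sM: "subspace M"
    using L M by (auto intro: lagrangian_subspace)
  have BL: "B \<subseteq> L" and CM: "C \<subseteq> M" and finC: "finite C" "card C < CARD('n)"
    using B assms(3,4) card_image_le[OF \<open>finite B\<close>, of "\<lambda>b. rot (- t b) b"]
    by (auto simp: C_def angle_space_def)
  have unit: "\<exists>x. x \<in> K \<and> norm x = 1 \<and> (\<forall>b\<in>F. x \<bullet> b = 0)"
    if "lagrangian K" "F \<subseteq> K" "finite F" "card F < CARD('n)" for K F :: "(real ^ ('n + 'n)) set"
  proof -
    have sK: "span K = K" using that(1) lagrangian_subspace span_eq_iff by blast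
    have "span F \<subseteq> span K" using that(2) span_mono by blast
    moreover have "span F \<noteq> span K"
      using that dim_le_card'[OF that(3)] dim_lagrangian[OF that(1)] by (metis dim_span not_less)
    ultimately have "span F \<subset> span K" by blast
    then obtain x where x: "x \<noteq> 0" "x \<in> span K" "\<And>y. y \<in> span F \<Longrightarrow> orthogonal x y"
      using orthogonal_to_subspace_exists_gen by metis
    have "(1 / norm x) *\<^sub>R x \<in> K"
      using x(2) sK by (metis span_mul)
    moreover have "\<forall>b\<in>F. ((1 / norm x) *\<^sub>R x) \<bullet> b = 0"
      using x(3) span_base by (auto simp: orthogonal_def)
    ultimately show ?thesis using x(1) by (intro exI[of _ "(1 / norm x) *\<^sub>R x"]) simp
  qed
  have sL': "subspace L'" and sM': "subspace M'"
    using sL sM by (auto simp: L'_def M'_def subspace_def inner_add_left)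
  obtain u0 m0 where "u0 \<in> L' \<inter> sphere 0 1" "m0 \<in> M' \<inter> sphere 0 1"
    using unit[OF L BL assms(3,4)] unit[OF M CM finC] by (auto simp: L'_def M'_def)
  then have ne: "(L' \<inter> sphere 0 1) \<times> (M' \<inter> sphere 0 1) \<noteq> {}" by blast
  have cpt: "compact ((L' \<inter> sphere 0 1) \<times> (M' \<inter> sphere 0 1))"
    using sL' sM' by (intro compact_Times closed_Int_compact closed_subspace) auto
  have cont: "continuous_on ((L' \<inter> sphere 0 1) \<times> (M' \<inter> sphere 0 1)) (\<lambda>p. fst p \<bullet> snd p)"
    by (intro continuous_intros)
  obtain p where p: "p \<in> (L' \<inter> sphere 0 1) \<times> (M' \<inter> sphere 0 1)"
    "\<forall>q \<in> (L' \<inter> sphere 0 1) \<times> (M' \<inter> sphere 0 1). fst q \<bullet> snd q \<le> fst p \<bullet> snd p"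
    using continuous_attains_sup[OF cpt ne cont] by blast
  define u m where "u = fst p" and "m = snd p"
  have u: "u \<in> L'" "norm u = 1" and m: "m \<in> M'" "norm m = 1"
    using p(1) by (auto simp: u_def m_def)
  have max: "x \<bullet> y \<le> u \<bullet> m" if "x \<in> L'" "norm x = 1" "y \<in> M'" "norm y = 1" for x y
    using p(2) that by (auto simp: u_def m_def)
  have uu: "u \<bullet> u = 1" and mm: "m \<bullet> m = 1"
    using u(2) m(2) by (simp_all add: power2_norm_eq_inner[symmetric])
  define \<sigma> where "\<sigma> = u \<bullet> m"
  have eqL: "x \<bullet> m = \<sigma> * (x \<bullet> u)" if "x \<in> L'" for x
    unfolding \<sigma>_def using sphere_maximizer_inner[OF sL' u] max m that by blast
  have eqM: "x \<bullet> u = \<sigma> * (x \<bullet> m)" if "x \<in> M'" for x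
  proof -
    have "y \<bullet> u \<le> m \<bullet> u" if "y \<in> M'" "norm y = 1" for y
      using max[OF u that] by (simp add: inner_commute)
    then show ?thesis
      using sphere_maximizer_inner[OF sM' m, of u x] that by (simp add: inner_commute \<sigma>_def)
  qed
  have uL: "u \<in> L" and mM: "m \<in> M" using u m by (auto simp: L'_def M'_def)
  have ub: "u \<bullet> b = 0" "J u \<bullet> b = 0" if "b \<in> B" for b
    using u that BL lagrangian_isotropic[OF L uL] by (auto simp: L'_def)
  have mc: "m \<bullet> rot (- t b) b = 0" "J m \<bullet> rot (- t b) b = 0" if "b \<in> B" for b
    using m that CM lagrangian_isotropic[OF M mM] by (auto simp: M'_def C_def)
  have mb: "m \<bullet> b = 0" "J m \<bullet> b = 0" if "b \<in> B" for b
  proof -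
    define c where "c = rot (- t b) b"
    have "b = cos (t b) *\<^sub>R c + sin (t b) *\<^sub>R J c"
      unfolding rot_def[symmetric] by (simp add: c_def)
    then have "x \<bullet> b = cos (t b) * (x \<bullet> c) + sin (t b) * (x \<bullet> J c)" for x
      by (metis inner_add_right inner_scaleR_right)
    then have "x \<bullet> b = cos (t b) * (x \<bullet> c) - sin (t b) * (J x \<bullet> c)" for x
      by (simp add: J_inner_left)
    from this[of m] this[of "J m"] mc[OF that, folded c_def] show "m \<bullet> b = 0" "J m \<bullet> b = 0"
      by simp_all
  qed
  have uc: "u \<bullet> rot (- t b) b = 0" if "b \<in> B" for b
    using ub[OF that] by (simp add: rot_def inner_add_right inner_diff_right J_inner_left)
  \<comment> \<open>Maximality controls \<open>w\<close> only against vectors orthogonal to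
    \<open>F\<close>; as \<open>w\<close> is orthogonal to \<open>F\<close> too, splitting off the
    projection onto \<open>span F\<close> covers all of \<open>K\<close>.\<close>
  have perp: "w \<bullet> x = 0" if K: "subspace K" "F \<subseteq> K" "x \<in> K"
    and w: "\<And>f. f \<in> F \<Longrightarrow> w \<bullet> f = 0" "\<And>y. y \<in> K \<Longrightarrow> (\<And>f. f \<in> F \<Longrightarrow> y \<bullet> f = 0) \<Longrightarrow> w \<bullet> y = 0"
    for K F :: "(real ^ ('n + 'n)) set" and w x
  proof -
    obtain y z where yz: "y \<in> span F" "\<And>v. v \<in> span F \<Longrightarrow> orthogonal z v" "x = y + z"
      using orthogonal_subspace_decomp_exists[of F x] by blast
    have "y \<in> K" using yz(1) K by (metis span_mono span_eq_iff subsetD)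
    then have "z \<in> K" using yz(3) K by (metis add_diff_cancel_left' subspace_diff)
    moreover have "z \<bullet> f = 0" if "f \<in> F" for f
      using yz(2) span_base that by (auto simp: orthogonal_def)
    ultimately have "w \<bullet> z = 0" using w(2) by blast
    moreover have "orthogonal w y"
      using orthogonal_to_span[OF yz(1), of w] w(1) by (auto simp: orthogonal_def)
    ultimately show ?thesis by (simp add: yz(3) inner_add_right orthogonal_def)
  qed
  \<comment> \<open>What remains of \<open>m\<close> after removing its component along
    \<open>u\<close> is orthogonal to the whole of \<open>L\<close>, so \<open>J\<close> sends it
    into \<open>L\<close>.\<close>
  define v where "v = J (\<sigma> *\<^sub>R u - m)"
  have "(\<sigma> *\<^sub>R u - m) \<bullet> x = 0" if "x \<in> L" for x
  proof (rule perp[OF sL BL that])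
    fix y assume "y \<in> L" "\<And>f. f \<in> B \<Longrightarrow> y \<bullet> f = 0"
    then have "y \<in> L'" by (simp add: L'_def)
    then show "(\<sigma> *\<^sub>R u - m) \<bullet> y = 0"
      using eqL[of y] by (simp add: inner_diff_left inner_diff_right inner_commute)
  qed (simp add: inner_diff_left ub mb)
  then have vL: "v \<in> L"
    unfolding v_def using lagrangian_maximal[OF L] by blast
  have "(\<sigma> *\<^sub>R m - u) \<bullet> x = 0" if "x \<in> M" for x
  proof (rule perp[OF sM CM that])
    fix y assume "y \<in> M" "\<And>f. f \<in> C \<Longrightarrow> y \<bullet> f = 0"
    then have "y \<in> M'" by (simp add: M'_def)
    then show "(\<sigma> *\<^sub>R m - u) \<bullet> y = 0"
      using eqM[of y] by (simp add: inner_diff_left inner_diff_right inner_commute)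
  qed (auto simp: C_def inner_diff_left uc mc)
  then have "J (\<sigma> *\<^sub>R m - u) \<in> M"
    using lagrangian_maximal[OF M] by blast
  moreover have m_eq: "m = \<sigma> *\<^sub>R u + J v" by (simp add: v_def)
  ultimately have "(\<sigma>\<^sup>2 - 1) *\<^sub>R J u - \<sigma> *\<^sub>R v \<in> M"
    by (simp add: algebra_simps power2_eq_square)
  then have yM: "(1 - \<sigma>\<^sup>2) *\<^sub>R J u + \<sigma> *\<^sub>R v \<in> M"
    using subspace_neg[OF sM] by (fastforce simp: algebra_simps)
  have vb: "v \<bullet> b = 0" if "b \<in> B" for b
    using ub[OF that] mb[OF that] by (simp add: v_def inner_diff_left)
  define \<rho> where "\<rho> = norm v"
  have "v \<bullet> v = 1 - \<sigma>\<^sup>2"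
    by (simp add: v_def inner_diff_left inner_diff_right uu mm power2_eq_square \<sigma>_def inner_commute
        del: J_linear_simps)
  then have \<rho>: "\<rho>\<^sup>2 = 1 - \<sigma>\<^sup>2" "\<rho> \<ge> 0"
    by (simp_all add: \<rho>_def power2_norm_eq_inner)
  show ?thesis
  proof (cases "\<rho> = 0")
    case True
    then have "v = 0" "\<sigma>\<^sup>2 = 1" using \<rho> by (simp_all add: \<rho>_def)
    then have "\<sigma> *\<^sub>R m = u" using m_eq by (simp add: power2_eq_square)
    then have "u \<in> M" using mM sM subspace_mul by blast
    then have "u \<in> angle_space L M 0" using uL by (simp add: angle_space_def)
    then show ?thesis using u ub by blast
  next
    case False
    define w where "w = (1 / \<rho>) *\<^sub>R v"
    have v: "v = \<rho> *\<^sub>R w" using False by (simp add: w_def)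
    have wL: "w \<in> L" using vL sL subspace_mul by (auto simp: w_def)
    have "\<sigma>\<^sup>2 + \<rho>\<^sup>2 = 1" using \<rho> by simp
    then obtain \<phi> where \<phi>: "\<sigma> = cos \<phi>" "\<rho> = sin \<phi>"
      using sincos_total_2pi by metis
    have "(1 / \<rho>) *\<^sub>R ((1 - \<sigma>\<^sup>2) *\<^sub>R J u + \<sigma> *\<^sub>R v) \<in> M"
      using yM sM subspace_mul by blast
    moreover have "(1 / \<rho>) *\<^sub>R ((1 - \<sigma>\<^sup>2) *\<^sub>R J u + \<sigma> *\<^sub>R v) = \<rho> *\<^sub>R J u + \<sigma> *\<^sub>R w"
      unfolding \<rho>(1)[symmetric] using False by (simp add: v scaleR_add_right power2_eq_square)
    \<comment> \<open>The second summand makes the sum symmetric in \<open>u\<close> and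
      \<open>w\<close>, hence a rotation of \<open>u + w\<close>.\<close>
    ultimately have "m + (\<rho> *\<^sub>R J u + \<sigma> *\<^sub>R w) \<in> M"
      using mM sM by (simp add: subspace_add)
    also have "m + (\<rho> *\<^sub>R J u + \<sigma> *\<^sub>R w) = rot \<phi> (u + w)"
      by (subst m_eq) (simp add: v rot_def \<phi> algebra_simps)
    finally have rM: "rot \<phi> (u + w) \<in> M" .
    show ?thesis
    proof (cases "u + w = 0")
      case True
      then have "w = - u" by (simp add: eq_neg_iff_add_eq_0 add.commute)
      then have "m = rot (- \<phi>) u"
        by (subst m_eq) (simp add: v rot_def \<phi>)
      then have "u \<in> angle_space L M \<phi>" using mM uL by (simp add: angle_space_def)
      then show ?thesis using u ub by blast
    next
      case ne: False
      let ?a = "(1 / norm (u + w)) *\<^sub>R (u + w)"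
      have "?a \<in> L" "rot \<phi> ?a \<in> M"
        using uL wL rM sL sM subspace_mul[OF sM rM, of "1 / norm (u + w)"]
        by (simp_all only: rot_linear_simps) (simp add: subspace_mul subspace_add)
      then have "?a \<in> angle_space L M (- \<phi>)" by (simp add: angle_space_def)
      moreover have "\<forall>b\<in>B. ?a \<bullet> b = 0"
        using ub vb by (simp add: inner_add_left w_def)
      moreover have "norm ?a = 1" using ne by simp
      ultimately show ?thesis by blast
    qed
  qed
qed

text \<open>The extension lemma adds one vector at a time until there are \<open>n\<close>. Since
  angle spaces repeat with period \<open>pi\<close>, each angle can then be moved into a prescribed
  half-open window of that length.\<close>

lemma angle_frame_exists:
  fixes L M :: "(real ^ ('n::finite + 'n)) set"
  assumes L: "lagrangian L" and M: "lagrangian M"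
  shows "\<exists>u \<theta>. angle_frame L M u \<theta> \<and> (\<forall>i. \<alpha> < \<theta> $ i \<and> \<theta> $ i \<le> \<alpha> + pi)"
proof -
  have "\<exists>B. finite B \<and> card B = k \<and> (\<forall>b\<in>B. \<forall>c\<in>B. b \<bullet> c = (if b = c then 1 else 0)) \<and>
      (\<forall>b\<in>B. \<exists>t. b \<in> angle_space L M t)" if "k \<le> CARD('n)" for k
    using that
  proof (induction k)
    case 0
    show ?case by (intro exI[of _ "{}"]) simp
  next
    case (Suc k)
    then obtain B where B: "finite B" "card B = k"
      "\<forall>b\<in>B. \<forall>c\<in>B. b \<bullet> c = (if b = c then 1 else 0)" "\<forall>b\<in>B. \<exists>t. b \<in> angle_space L M t"
      by (auto dest: Suc_leD)
    from B(4) obtain t where "\<And>b. b \<in> B \<Longrightarrow> b \<in> angle_space L M (t b)" by metis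
    from angle_space_extension[OF L M B(1) _ this] B(2) Suc.prems
    obtain a s where a: "norm a = 1" "\<forall>b\<in>B. a \<bullet> b = 0" "a \<in> angle_space L M s" by auto
    have aa: "a \<bullet> a = 1" using a(1) by (simp add: power2_norm_eq_inner[symmetric])
    then have "a \<notin> B" using a(2) by force
    then have "card (insert a B) = Suc k" using B by simp
    moreover have "\<forall>b\<in>insert a B. \<forall>c\<in>insert a B. b \<bullet> c = (if b = c then 1 else 0)"
      using a(2) aa B(3) \<open>a \<notin> B\<close> by (auto simp: inner_commute)
    moreover have "\<forall>b\<in>insert a B. \<exists>t. b \<in> angle_space L M t" using a(3) B(4) by blast
    ultimately show ?case using B(1) by (intro exI[of _ "insert a B"]) simp
  qed
  from this[of "CARD('n)"] obtain B where B: "finite B" "card B = CARD('n)"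
    "\<forall>b\<in>B. \<forall>c\<in>B. b \<bullet> c = (if b = c then 1 else 0)" "\<forall>b\<in>B. \<exists>t. b \<in> angle_space L M t"
    by auto
  obtain f where f: "bij_betw f (UNIV :: 'n set) B"
    using finite_same_card_bij[of "UNIV :: 'n set" B] B by auto
  have window: "\<exists>t. b \<in> angle_space L M t \<and> \<alpha> < t \<and> t \<le> \<alpha> + pi" if "b \<in> B" for b
  proof -
    from that B(4) obtain t where t: "b \<in> angle_space L M t" by blast
    \<comment> \<open>The number of half-turns that moves \<open>t\<close> into
      \<open>(\<alpha>, \<alpha> + pi]\<close>.\<close>
    let ?k = "\<lfloor>(\<alpha> + pi - t) / pi\<rfloor>"
    have "of_int ?k \<le> (\<alpha> + pi - t) / pi" "(\<alpha> + pi - t) / pi < of_int ?k + 1"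
      by linarith+
    then have "of_int ?k * pi \<le> \<alpha> + pi - t" "\<alpha> + pi - t < (of_int ?k + 1) * pi"
      using pi_gt_zero by (simp_all only: pos_le_divide_eq pos_divide_less_eq)
    then have "\<alpha> < t + of_int ?k * pi" "t + of_int ?k * pi \<le> \<alpha> + pi"
      by (simp_all add: algebra_simps)
    then show ?thesis
      using t angle_space_int_pi[OF lagrangian_subspace[OF M]] by blast
  qed
  then obtain t where t: "\<And>b. b \<in> B \<Longrightarrow> b \<in> angle_space L M (t b) \<and> \<alpha> < t b \<and> t b \<le> \<alpha> + pi"
    by metis
  have fB: "f i \<in> B" "f i = f j \<longleftrightarrow> i = j" for i j
    using f by (auto simp: bij_betw_def inj_on_def)
  have "angle_frame L M (\<chi> i. f i) (\<chi> i. t (f i))"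
    using t B(3) fB by (simp add: angle_frame_def)
  then show ?thesis using t fB
    by (intro exI[of _ "\<chi> i. f i"] exI[of _ "\<chi> i. t (f i)"]) simp
qed

text \<open>The frame diagonalises the pair: a vector of the angle space at \<open>t\<close> is
  orthogonal to each frame vector whose angle differs from \<open>t\<close> modulo
  \<open>pi\<close>, so its expansion involves only the others.\<close>

lemma dim_angle_space:
  fixes L M :: "(real ^ ('n::finite + 'n)) set"
  assumes L: "lagrangian L" and M: "lagrangian M" and fr: "angle_frame L M u \<theta>"
  shows "dim (angle_space L M t) = card {i. sin (\<theta> $ i - t) = 0}"
proof -
  have on: "u $ i \<bullet> u $ j = (if i = j then 1 else 0)" and uA: "u $ i \<in> angle_space L M (\<theta> $ i)" for i j
    using fr by (auto simp: angle_frame_def)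
  have sL: "subspace L" and sM: "subspace M"
    using L M by (auto intro: lagrangian_subspace)
  have inj: "inj (($) u)"
    by (rule injI) (metis on zero_neq_one)
  have uL: "range (($) u) \<subseteq> L" using uA by (auto simp: angle_space_def)
  have ind: "independent (range (($) u))"
  proof (rule pairwise_orthogonal_independent)
    show "0 \<notin> range (($) u)" using on by (metis imageE inner_zero_left zero_neq_one)
    show "pairwise orthogonal (range (($) u))"
      by (auto simp: pairwise_def orthogonal_def on)
  qed
  have "L \<subseteq> span (range (($) u))"
    by (rule card_ge_dim_independent[OF uL ind])
      (simp add: dim_lagrangian[OF L] card_image[OF inj])
  have expand: "v = (\<Sum>i\<in>UNIV. (v \<bullet> u $ i) *\<^sub>R u $ i)" if "v \<in> L" for v
  proof -
    let ?w = "v - (\<Sum>i\<in>UNIV. (v \<bullet> u $ i) *\<^sub>R u $ i)"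
    have "?w \<in> L" using that uL sL by (intro subspace_diff subspace_sum subspace_mul) auto
    then have w: "?w \<in> span (range (($) u))" using \<open>L \<subseteq> _\<close> by blast
    have "orthogonal ?w y" if "y \<in> range (($) u)" for y
      using that by (auto simp: orthogonal_def inner_diff_left inner_sum_left on if_distrib cong: if_cong)
    then have "orthogonal ?w ?w" using orthogonal_to_span[OF w] by blast
    then show ?thesis by (simp add: orthogonal_self)
  qed
  let ?I = "{i. sin (\<theta> $ i - t) = 0}"
  have "dim (angle_space L M t) = card (($) u ` ?I)"
  proof (rule dim_unique)
    show "($) u ` ?I \<subseteq> angle_space L M t"
      using uA angle_space_sin_eq_0[OF sM] by blast
    show "angle_space L M t \<subseteq> span (($) u ` ?I)"
    proof
      fix v assume v: "v \<in> angle_space L M t"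
      have "(v \<bullet> u $ i) *\<^sub>R u $ i \<in> span (($) u ` ?I)" for i
      proof (cases "i \<in> ?I")
        case True
        then show ?thesis by (intro span_mul span_base) blast
      next
        case False
        then have "u $ i \<bullet> v = 0" using angle_spaces_orthogonal[OF L M uA v] by simp
        then show ?thesis by (simp add: inner_commute span_zero)
      qed
      then show "v \<in> span (($) u ` ?I)"
        using expand[of v] v by (metis (no_types, lifting) angle_space_def mem_Collect_eq span_sum)
    qed
    show "independent (($) u ` ?I)" using ind by (rule independent_mono) blast
  qed simp
  also have "\<dots> = card ?I" using inj by (intro card_image) (meson inj_on_subset subset_UNIV)
  finally show ?thesis .
qed

text \<open>The window contains \<open>[0, a]\<close>, and two of its points that differ by a
  multiple of \<open>pi\<close> coincide. So the dimensions summed in the count are the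
  multiplicities of the listed angles.\<close>

lemma maslov_count_eq_card:
  fixes L M :: "(real ^ ('n::finite + 'n)) set"
  assumes L: "lagrangian L" and M: "lagrangian M" and fr: "angle_frame L M u \<theta>"
    and \<theta>: "\<And>i. \<alpha> < \<theta> $ i \<and> \<theta> $ i \<le> \<alpha> + pi" and a: "\<alpha> < 0" "a \<le> \<alpha> + pi"
  shows "maslov_count L M a = card {i. 0 \<le> \<theta> $ i \<and> \<theta> $ i \<le> a}"
proof -
  let ?I = "{i. 0 \<le> \<theta> $ i \<and> \<theta> $ i \<le> a}"
  have sub: "subspace (angle_space L M t)" for t
    using L M lagrangian_subspace subspace_angle_space by blast
  have eq: "sin (\<theta> $ i - t) = 0 \<longleftrightarrow> \<theta> $ i = t" if "0 \<le> t" "t \<le> a" for i t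
    using sin_eq_0_pi[of "\<theta> $ i - t"] \<theta>[of i] a that by auto
  have dim: "dim (rot_inter L M t) = card {i. \<theta> $ i = t}" if "0 \<le> t" "t \<le> a" for t
    by (simp add: dim_rot_inter dim_angle_space[OF L M fr] eq[OF that])
  have "rot_inter L M t \<noteq> {0} \<longleftrightarrow> t \<in> ($) \<theta> ` ?I" if "0 \<le> t" "t \<le> a" for t
  proof -
    have "rot_inter L M t = {0} \<longleftrightarrow> dim (rot_inter L M t) = 0"
      unfolding rot_inter_trivial_iff dim_rot_inter dim_eq_0 using subspace_0[OF sub[of t]] by blast
    then show ?thesis unfolding dim[OF that] using that by auto
  qed
  then have "{t. 0 \<le> t \<and> t \<le> a \<and> rot_inter L M t \<noteq> {0}} = ($) \<theta> ` ?I" by auto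
  then have "maslov_count L M a = (\<Sum>t\<in>($) \<theta> ` ?I. dim (rot_inter L M t))"
    by (simp add: maslov_count_def)
  also have "\<dots> = (\<Sum>t\<in>($) \<theta> ` ?I. \<Sum>i | i \<in> ?I \<and> \<theta> $ i = t. 1)"
    by (intro sum.cong) (auto simp: dim intro!: arg_cong[of _ _ card])
  also have "\<dots> = (\<Sum>i\<in>?I. 1)"
    by (rule sum.image_gen[symmetric]) simp
  finally show ?thesis by simp
qed

section \<open>From local to global: sequences and order\<close>

text \<open>One good index per sequence suffices, because a sequence that fails infinitely often has
  a subsequence that always fails. This suits compactness arguments, which control only an extracted
  subsequence.\<close>

lemma eventually_at_within_sequentiallyI:
  fixes x :: "'a::metric_space"
  assumes "\<And>\<xi>. (\<And>k. \<xi> k \<in> X - {x}) \<Longrightarrow> \<xi> \<longlonglongrightarrow> x \<Longrightarrow> \<exists>k. P (\<xi> k)"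
  shows "\<forall>\<^sub>F y in at x within X. P y"
proof (rule sequentially_imp_eventually_within, intro allI impI, rule ccontr)
  fix \<xi> :: "nat \<Rightarrow> 'a"
  assume \<xi>: "(\<forall>n. \<xi> n \<in> X \<and> \<xi> n \<noteq> x) \<and> \<xi> \<longlonglongrightarrow> x" and "\<not> (\<forall>\<^sub>F n in sequentially. P (\<xi> n))"
  then obtain r :: "nat \<Rightarrow> nat" where r: "strict_mono r" "\<And>n. \<not> P (\<xi> (r n))"
    using not_eventually_sequentiallyD by blast
  have "(\<xi> \<circ> r) \<longlonglongrightarrow> x"
    using \<xi> r(1) LIMSEQ_subseq_LIMSEQ by blast
  then show False
    using assms[of "\<xi> \<circ> r"] \<xi> r(2) by auto
qed

text \<open>Continuity is replaced by a supremum argument: at the supremum \<open>c\<close> of the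
  points with \<open>f a \<le> f x\<close>, the left half of \<open>loc\<close> puts
  \<open>c\<close> into the set, and the right half leads beyond it unless
  \<open>c = b\<close>.\<close>

lemma local_mono_imp_le:
  fixes f :: "real \<Rightarrow> 'a::linorder"
  assumes "a \<le> b"
    and loc: "\<And>s. s \<in> {a..b} \<Longrightarrow>
      \<forall>\<^sub>F y in at s within {a..b}. (y < s \<longrightarrow> f y \<le> f s) \<and> (s < y \<longrightarrow> f s \<le> f y)"
  shows "f a \<le> f b"
proof -
  define S where "S = {x \<in> {a..b}. f a \<le> f x}"
  have S: "a \<in> S" "bdd_above S" using assms(1) by (auto simp: S_def intro: bdd_aboveI[of _ b])
  define c where "c = Sup S"
  have c: "c \<in> {a..b}"
  proof -
    have "a \<le> c" unfolding c_def by (rule cSup_upper[OF S])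
    moreover have "c \<le> b" unfolding c_def using S(1) by (intro cSup_least) (auto simp: S_def)
    ultimately show ?thesis by simp
  qed
  obtain d where d: "d > 0" "\<And>y. y \<in> {a..b} \<Longrightarrow> y \<noteq> c \<Longrightarrow> dist y c < d \<Longrightarrow>
      (y < c \<longrightarrow> f y \<le> f c) \<and> (c < y \<longrightarrow> f c \<le> f y)"
    using loc[OF c] unfolding eventually_at by blast
  obtain x where x: "x \<in> S" "c - d < x"
    using less_cSupD[of S "c - d"] S d(1) by (auto simp: c_def)
  have "x \<le> c" using x(1) S(2) by (simp add: c_def cSup_upper)
  then have fc: "f a \<le> f c"
    using d(2)[of x] x by (cases "x = c") (auto simp: S_def dist_real_def)
  show ?thesis
  proof (cases "c = b")
    case False
    define y where "y = min b (c + d / 2)"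
    have "y \<in> {a..b}" "c < y" "dist y c < d"
      using False c d(1) by (auto simp: y_def dist_real_def min_def)
    then have "f c \<le> f y" using d(2)[of y] by auto
    then have "y \<in> S" using fc \<open>y \<in> {a..b}\<close> by (auto simp: S_def)
    then have "y \<le> c" using S(2) by (simp add: c_def cSup_upper)
    then show ?thesis using \<open>c < y\<close> by simp
  qed (use fc in simp)
qed

subsection \<open>Closed families of Lagrangian subspaces\<close>

text \<open>For Lagrangian subspaces, closedness of the graph \<open>{(x, v). v \<in> L x}\<close> is equivalent to
  continuity of \<open>L\<close> in the Grassmannian, the dimension being constant.\<close>

definition closed_family ::
  "'x::metric_space set \<Rightarrow> ('x \<Rightarrow> (real ^ ('n::finite + 'n)) set) \<Rightarrow> bool" where
  "closed_family X L \<longleftrightarrow> (\<forall>x\<in>X. lagrangian (L x)) \<and>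
     (\<forall>\<xi> x v w. (\<forall>k. \<xi> k \<in> X \<and> v k \<in> L (\<xi> k)) \<longrightarrow> \<xi> \<longlonglongrightarrow> x \<longrightarrow> x \<in> X \<longrightarrow>
        v \<longlonglongrightarrow> w \<longrightarrow> w \<in> L x)"

lemma closed_family_lagrangian: "closed_family X L \<Longrightarrow> x \<in> X \<Longrightarrow> lagrangian (L x)"
  by (simp add: closed_family_def)

lemma closed_family_limit:
  assumes "closed_family X L" "x \<in> X" "\<And>k. \<xi> k \<in> X" "\<And>k. v k \<in> L (\<xi> k)" "\<xi> \<longlonglongrightarrow> x" "v \<longlonglongrightarrow> w"
  shows "w \<in> L x"
  using assms unfolding closed_family_def by blast

lemma closed_family_compose:
  assumes "closed_family X L" "continuous_on Y g" "g ` Y \<subseteq> X"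
  shows "closed_family Y (\<lambda>y. L (g y))"
  unfolding closed_family_def
proof (intro conjI ballI allI impI)
  fix y assume "y \<in> Y"
  then show "lagrangian (L (g y))"
    using assms closed_family_lagrangian by blast
next
  fix \<xi> y v w
  assume h: "\<forall>k. \<xi> k \<in> Y \<and> v k \<in> L (g (\<xi> k))" "\<xi> \<longlonglongrightarrow> y" "y \<in> Y" "v \<longlonglongrightarrow> w"
  have "(\<lambda>k. g (\<xi> k)) \<longlonglongrightarrow> g y"
    by (rule continuous_on_tendsto_compose[OF assms(2) h(2,3)]) (use h(1) in simp)
  then show "w \<in> L (g y)"
    using closed_family_limit[OF assms(1), of "g y" "\<lambda>k. g (\<xi> k)" v w] assms(3) h by blast
qed

lemma closed_family_subset: "closed_family X L \<Longrightarrow> Y \<subseteq> X \<Longrightarrow> closed_family Y L"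
  using closed_family_compose[of X L Y "\<lambda>x. x"] by auto

lemma closed_family_const: "lagrangian K \<Longrightarrow> closed_family X (\<lambda>x. K)"
  unfolding closed_family_def
  using closed_sequentially[OF closed_subspace] lagrangian_subspace by blast

locale lagrangian_families =
  fixes X :: "'x::metric_space set" and L M :: "'x \<Rightarrow> (real ^ ('n::finite + 'n)) set"
  assumes L: "closed_family X L" and M: "closed_family X M"
begin

text \<open>Read "nonresonant": \<open>a\<close> is not a relative angle at \<open>x\<close>, so
  nearby no angle enters or leaves a counting window through \<open>a\<close>.\<close>

definition nonres :: "'x \<Rightarrow> real \<Rightarrow> bool" where
  "nonres x a \<longleftrightarrow> angle_space (L x) (M x) a = {0}"

definition count :: "'x \<Rightarrow> real \<Rightarrow> int" where
  "count x a = int (maslov_count (L x) (M x) a)"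

lemma LX: "x \<in> X \<Longrightarrow> lagrangian (L x)" and MX: "x \<in> X \<Longrightarrow> lagrangian (M x)"
  using L M closed_family_lagrangian by blast+

lemma angle_space_limit:
  assumes "x \<in> X" "\<And>k. \<xi> k \<in> X" "\<xi> \<longlonglongrightarrow> x" "t \<longlonglongrightarrow> s" "v \<longlonglongrightarrow> w"
    and "\<And>k. v k \<in> angle_space (L (\<xi> k)) (M (\<xi> k)) (t k)"
  shows "w \<in> angle_space (L x) (M x) s"
proof -
  have v: "v k \<in> L (\<xi> k)" "rot (- t k) (v k) \<in> M (\<xi> k)" for k
    using assms(6)[of k] by (auto simp: angle_space_def)
  have "w \<in> L x"
    using closed_family_limit[OF L assms(1) assms(2) v(1) assms(3,5)] .
  moreover have "(\<lambda>k. rot (- t k) (v k)) \<longlonglongrightarrow> rot (- s) w"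
    using assms by (intro tendsto_rot tendsto_minus)
  then have "rot (- s) w \<in> M x"
    using closed_family_limit[OF M assms(1) assms(2) v(2) assms(3)] by blast
  ultimately show ?thesis by (simp add: angle_space_def)
qed

lemma nonres_frame:
  assumes "angle_frame (L x) (M x) u \<theta>" "nonres x a"
  shows "\<theta> $ i \<noteq> a"
proof
  assume "\<theta> $ i = a"
  then have "u $ i = 0" using assms unfolding angle_frame_def nonres_def by (metis singletonD)
  moreover have "u $ i \<bullet> u $ i = 1" using assms(1) by (simp add: angle_frame_def)
  ultimately show False by simp
qed

lemma nonres_pi: "x \<in> X \<Longrightarrow> nonres x (a + pi) \<longleftrightarrow> nonres x a"
  by (simp add: nonres_def angle_space_pi lagrangian_subspace MX)

text \<open>Resonance passes to limits: unit angle vectors at nearby parameters accumulate, by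
  compactness, at a unit angle vector.\<close>

lemma eventually_nonres:
  assumes "x \<in> X" "nonres x a"
  shows "\<forall>\<^sub>F y in at x within X. nonres y a"
proof (rule eventually_at_within_sequentiallyI, rule ccontr)
  fix \<xi> assume \<xi>: "\<And>k. \<xi> k \<in> X - {x}" "\<xi> \<longlonglongrightarrow> x" and "\<nexists>k. nonres (\<xi> k) a"
  have "\<exists>v. v \<in> angle_space (L (\<xi> k)) (M (\<xi> k)) a \<and> norm v = 1" for k
  proof -
    have sub: "subspace (angle_space (L (\<xi> k)) (M (\<xi> k)) a)"
      using \<xi>(1) by (intro subspace_angle_space lagrangian_subspace LX MX) auto
    then obtain v where "v \<in> angle_space (L (\<xi> k)) (M (\<xi> k)) a" "v \<noteq> 0"
      using \<open>\<nexists>k. nonres (\<xi> k) a\<close> subspace_0 unfolding nonres_def by blast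
    then show ?thesis using sub
      by (intro exI[of _ "(1 / norm v) *\<^sub>R v"]) (simp add: subspace_mul)
  qed
  then obtain v where v: "\<And>k. v k \<in> angle_space (L (\<xi> k)) (M (\<xi> k)) a" "\<And>k. norm (v k) = 1"
    by metis
  then have "bounded (range v)" unfolding bounded_iff by (intro exI[of _ 1]) simp
  then obtain w r where r: "strict_mono r" "(v \<circ> r) \<longlonglongrightarrow> w"
    using bounded_imp_convergent_subsequence by blast
  have "w \<in> angle_space (L x) (M x) a"
    by (rule angle_space_limit[of x "\<xi> \<circ> r" "\<lambda>_. a" _ "v \<circ> r"])
      (use assms \<xi> r v LIMSEQ_subseq_LIMSEQ in auto)
  then have "w = 0" using assms(2) by (simp add: nonres_def)
  moreover have "(\<lambda>k. norm ((v \<circ> r) k)) \<longlonglongrightarrow> norm w"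
    using r(2) by (intro tendsto_norm)
  then have "norm w = 1" by (simp add: v(2) LIMSEQ_const_iff)
  ultimately show False by simp
qed

text \<open>The substitute for continuous angles. The ends of the window agree modulo
  \<open>pi\<close>, so nonresonance of \<open>\<alpha>\<close> keeps the limit angles off both, and
  the limit is a frame for the same window.\<close>

lemma angle_frame_limit:
  assumes x: "x \<in> X" "nonres x \<alpha>" and \<xi>: "\<And>k. \<xi> k \<in> X" "\<xi> \<longlonglongrightarrow> x"
  obtains r u \<theta> w \<phi> where "strict_mono r"
    and "\<And>k. angle_frame (L (\<xi> (r k))) (M (\<xi> (r k))) (u k) (\<theta> k)"
    and "\<And>k i. \<alpha> < \<theta> k $ i \<and> \<theta> k $ i \<le> \<alpha> + pi"
    and "angle_frame (L x) (M x) w \<phi>" and "\<And>i. \<alpha> < \<phi> $ i \<and> \<phi> $ i < \<alpha> + pi"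
    and "u \<longlonglongrightarrow> w" and "\<theta> \<longlonglongrightarrow> \<phi>"
proof -
  have "\<exists>u \<theta>. angle_frame (L (\<xi> k)) (M (\<xi> k)) u \<theta> \<and> (\<forall>i. \<alpha> < \<theta> $ i \<and> \<theta> $ i \<le> \<alpha> + pi)" for k
    using angle_frame_exists LX MX \<xi>(1) by blast
  then obtain u \<theta> where fr: "\<And>k. angle_frame (L (\<xi> k)) (M (\<xi> k)) (u k) (\<theta> k)"
    and win: "\<And>k i. \<alpha> < \<theta> k $ i \<and> \<theta> k $ i \<le> \<alpha> + pi"
    by metis
  have unit: "norm (u k $ i) = 1" for k i
    using fr[of k] by (simp add: angle_frame_def norm_eq_sqrt_inner)
  have vec: "norm y \<le> (\<Sum>i\<in>UNIV. norm (y $ i))" for y :: "'a::real_normed_vector ^ 'n"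
    unfolding norm_vec_def by (rule L2_set_le_sum) simp
  have "bounded (range u)"
  proof -
    have "norm (u k) \<le> CARD('n)" for k using vec[of "u k"] by (simp add: unit)
    then show ?thesis by (auto simp: bounded_iff)
  qed
  moreover have "norm (\<theta> k) \<le> (\<Sum>i\<in>(UNIV::'n set). \<bar>\<alpha>\<bar> + pi)" for k
  proof (rule order_trans[OF vec sum_mono])
    show "norm (\<theta> k $ i) \<le> \<bar>\<alpha>\<bar> + pi" for i using win[of k i] by auto
  qed
  then have "bounded (range \<theta>)" unfolding bounded_iff by blast
  ultimately have "bounded (range (\<lambda>k. (u k, \<theta> k)))"
    by (rule bounded_subset[OF bounded_Times]) auto
  then obtain l r where r: "strict_mono r" and lim: "((\<lambda>k. (u k, \<theta> k)) \<circ> r) \<longlonglongrightarrow> l"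
    using bounded_imp_convergent_subsequence by blast
  define w \<phi> where "w = fst l" and "\<phi> = snd l"
  have w: "(u \<circ> r) \<longlonglongrightarrow> w" and \<phi>: "(\<theta> \<circ> r) \<longlonglongrightarrow> \<phi>"
    using tendsto_fst[OF lim] tendsto_snd[OF lim] by (simp_all add: w_def \<phi>_def comp_def)
  have wi: "(\<lambda>k. u (r k) $ i) \<longlonglongrightarrow> w $ i" and \<phi>i: "(\<lambda>k. \<theta> (r k) $ i) \<longlonglongrightarrow> \<phi> $ i" for i
    using tendsto_vec_nth[OF w] tendsto_vec_nth[OF \<phi>] by (simp_all add: comp_def)
  have "w $ i \<bullet> w $ j = (if i = j then 1 else 0)" for i j
  proof -
    have "(\<lambda>k. u (r k) $ i \<bullet> u (r k) $ j) \<longlonglongrightarrow> w $ i \<bullet> w $ j"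
      by (intro tendsto_inner wi)
    moreover have "u (r k) $ i \<bullet> u (r k) $ j = (if i = j then 1 else 0)" for k
      using fr[of "r k"] by (simp add: angle_frame_def)
    ultimately show ?thesis
      using LIMSEQ_unique[of "\<lambda>_. if i = j then 1 else 0 :: real"] by auto
  qed
  moreover have "w $ i \<in> angle_space (L x) (M x) (\<phi> $ i)" for i
    by (rule angle_space_limit[OF x(1) _ _ \<phi>i wi, of "\<xi> \<circ> r"])
      (use \<xi> r fr LIMSEQ_subseq_LIMSEQ in \<open>auto simp: angle_frame_def\<close>)
  ultimately have frx: "angle_frame (L x) (M x) w \<phi>"
    by (simp add: angle_frame_def)
  have "\<alpha> < \<phi> $ i \<and> \<phi> $ i < \<alpha> + pi" for i
  proof -
    have "\<alpha> \<le> \<phi> $ i" "\<phi> $ i \<le> \<alpha> + pi"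
      using win less_imp_le LIMSEQ_le_const[OF \<phi>i[of i], of \<alpha>]
        LIMSEQ_le_const2[OF \<phi>i[of i], of "\<alpha> + pi"]
      by blast+
    moreover have "\<phi> $ i \<noteq> \<alpha>" "\<phi> $ i \<noteq> \<alpha> + pi"
      using nonres_frame[OF frx] x nonres_pi by blast+
    ultimately show ?thesis by simp
  qed
  with that[OF r _ _ frx _ w \<phi>] fr win show ?thesis by simp
qed

section \<open>Counts at neighbouring parameters\<close>

text \<open>Both counts start at 0, so whatever happens there cancels; the difference sees only the
  angles in \<open>(a, b]\<close>.\<close>

lemma count_diff:
  assumes "x \<in> X" "angle_frame (L x) (M x) u \<theta>" "\<And>i. b - pi < \<theta> $ i \<and> \<theta> $ i \<le> b"
    and "0 < a" "a \<le> b" "b < pi"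
  shows "count x b - count x a = int (card {i. a < \<theta> $ i})"
proof -
  have cnt: "count x c = int (card {i. 0 \<le> \<theta> $ i \<and> \<theta> $ i \<le> c})" if "c \<le> b" for c
    using maslov_count_eq_card[OF LX[OF assms(1)] MX[OF assms(1)] assms(2), of "b - pi" c] assms that
    by (simp add: count_def)
  have "{i. 0 \<le> \<theta> $ i \<and> \<theta> $ i \<le> b} = {i. 0 \<le> \<theta> $ i \<and> \<theta> $ i \<le> a} \<union> {i. a < \<theta> $ i}"
    using assms(3-5) by (auto intro: less_imp_le order_trans)
  moreover have "card ({i. 0 \<le> \<theta> $ i \<and> \<theta> $ i \<le> a} \<union> {i. a < \<theta> $ i}) =
      card {i. 0 \<le> \<theta> $ i \<and> \<theta> $ i \<le> a} + card {i. a < \<theta> $ i}"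
    by (rule card_Un_disjoint) auto
  ultimately show ?thesis using cnt[of a] cnt[of b] assms by simp
qed

lemma count_eq_card:
  assumes "x \<in> X" "angle_frame (L x) (M x) u \<theta>" "\<And>i. a - pi < \<theta> $ i \<and> \<theta> $ i \<le> a"
    and "0 < a" "a < pi"
  shows "count x a = int (card {i. 0 \<le> \<theta> $ i})"
  using maslov_count_eq_card[OF LX[OF assms(1)] MX[OF assms(1)] assms(2), of "a - pi" a] assms
  by (auto simp: count_def intro!: arg_cong[of _ _ card])

lemma count_bounds:
  assumes "x \<in> X" "0 < a" "a < pi"
  shows "0 \<le> count x a" "count x a \<le> int CARD('n)"
proof -
  obtain u \<theta> where "angle_frame (L x) (M x) u \<theta>" "\<And>i. a - pi < \<theta> $ i \<and> \<theta> $ i \<le> (a - pi) + pi"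
    using angle_frame_exists LX[OF assms(1)] MX[OF assms(1)] by blast
  then show "count x a \<le> int CARD('n)"
    using count_eq_card[of x u \<theta> a] assms by (simp add: card_mono)
qed (simp add: count_def)

lemma eventually_count_diff:
  assumes x: "x \<in> X" "nonres x a" "nonres x b" and ab: "a \<in> {0<..<pi}" "b \<in> {0<..<pi}"
  shows "\<forall>\<^sub>F y in at x within X. count y b - count y a = count x b - count x a"
proof -
  have main: "\<forall>\<^sub>F y in at x within X. count y b - count y a = count x b - count x a"
    if x: "x \<in> X" "nonres x a" "nonres x b" and ab: "0 < a" "a \<le> b" "b < pi" for a b
  proof (rule eventually_at_within_sequentiallyI)
    fix \<xi> assume \<xi>: "\<And>k. \<xi> k \<in> X - {x}" "\<xi> \<longlonglongrightarrow> x"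
    then have \<xi>X: "\<And>k. \<xi> k \<in> X" by blast
    \<comment> \<open>Up to a half-turn the window starts at \<open>b\<close>, so nonresonance of
      \<open>b\<close> guards both of its ends.\<close>
    have nb: "nonres x (b - pi)" using nonres_pi[OF x(1), of "b - pi"] x(3) by simp
    obtain r u \<theta> w \<phi> where r: "strict_mono r" and fr: "\<And>k. angle_frame (L (\<xi> (r k))) (M (\<xi> (r k))) (u k) (\<theta> k)"
      and win: "\<And>k i. b - pi < \<theta> k $ i \<and> \<theta> k $ i \<le> b - pi + pi"
      and frx: "angle_frame (L x) (M x) w \<phi>" and winx: "\<And>i. b - pi < \<phi> $ i \<and> \<phi> $ i < b - pi + pi"
      and ulim: "u \<longlonglongrightarrow> w" and lim: "\<theta> \<longlonglongrightarrow> \<phi>"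
      by (rule angle_frame_limit[OF x(1) nb \<xi>X \<xi>(2)]) (rule that)
    have "\<forall>\<^sub>F k in sequentially. a < \<theta> k $ i \<longleftrightarrow> a < \<phi> $ i" for i
    proof (cases "a < \<phi> $ i")
      case True
      then show ?thesis using order_tendstoD(1)[OF tendsto_vec_nth[OF lim] True] by simp
    next
      case False
      then have "\<phi> $ i < a" using nonres_frame[OF frx x(2), of i] by simp
      from order_tendstoD(2)[OF tendsto_vec_nth[OF lim] this] False
      show ?thesis by (auto elim: eventually_mono)
    qed
    then have "\<forall>\<^sub>F k in sequentially. \<forall>i. a < \<theta> k $ i \<longleftrightarrow> a < \<phi> $ i"
      by (simp add: eventually_all_finite)
    then obtain k where "\<And>i. a < \<theta> k $ i \<longleftrightarrow> a < \<phi> $ i"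
      using eventually_happens'[OF sequentially_bot] by blast
    then have "count (\<xi> (r k)) b - count (\<xi> (r k)) a = count x b - count x a"
      using count_diff[OF _ fr[of k], of b a] count_diff[OF x(1) frx, of b a] win[of k] winx ab \<xi>(1)
      by (simp add: less_imp_le)
    then show "\<exists>k. count (\<xi> k) b - count (\<xi> k) a = count x b - count x a" by blast
  qed
  show ?thesis
  proof (cases "a \<le> b")
    case True
    then show ?thesis using main[of a b] assms by simp
  next
    case False
    then have "\<forall>\<^sub>F y in at x within X. count y a - count y b = count x a - count x b"
      using main[of b a] assms by simp
    then show ?thesis by (rule eventually_mono) simp
  qed
qed

text \<open>With the window \<open>(a - pi, a]\<close> the count is the number of nonnegative
  angles. The three comparisons that follow thus reduce to the signs of convergent real
  sequences.\<close>

lemma count_limit: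
  assumes x: "x \<in> X" "nonres x a" "0 < a" "a < pi" and \<xi>: "\<And>k. \<xi> k \<in> X" "\<xi> \<longlonglongrightarrow> x"
  obtains r u \<theta> w \<phi> where "strict_mono r"
    and "\<And>k. angle_frame (L (\<xi> (r k))) (M (\<xi> (r k))) (u k) (\<theta> k)" and "angle_frame (L x) (M x) w \<phi>"
    and "\<And>k. count (\<xi> (r k)) a = int (card {i. 0 \<le> \<theta> k $ i})" and "count x a = int (card {i. 0 \<le> \<phi> $ i})"
    and "\<And>i. (\<lambda>k. \<theta> k $ i) \<longlonglongrightarrow> \<phi> $ i"
proof -
  have na: "nonres x (a - pi)" using nonres_pi[OF x(1), of "a - pi"] x(2) by simp
  obtain r u \<theta> w \<phi> where r: "strict_mono r"
    and fr: "\<And>k. angle_frame (L (\<xi> (r k))) (M (\<xi> (r k))) (u k) (\<theta> k)"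
    and win: "\<And>k i. a - pi < \<theta> k $ i \<and> \<theta> k $ i \<le> a - pi + pi"
    and frx: "angle_frame (L x) (M x) w \<phi>" and winx: "\<And>i. a - pi < \<phi> $ i \<and> \<phi> $ i < a - pi + pi"
    and ulim: "u \<longlonglongrightarrow> w" and lim: "\<theta> \<longlonglongrightarrow> \<phi>"
    by (rule angle_frame_limit[OF x(1) na \<xi>]) (rule that)
  have "count (\<xi> (r k)) a = int (card {i. 0 \<le> \<theta> k $ i})" for k
    using count_eq_card[OF \<xi>(1) fr[of k]] win x by simp
  moreover have "count x a = int (card {i. 0 \<le> \<phi> $ i})"
    using count_eq_card[OF x(1) frx] winx x by (simp add: less_imp_le)
  ultimately show ?thesis using that[OF r fr frx] tendsto_vec_nth[OF lim] by blast
qed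

text \<open>Angles with a negative limit become negative, while a zero limit may be approached from
  either side. As 0 is counted, nearby counts can drop but not rise.\<close>

lemma eventually_count_le:
  assumes x: "x \<in> X" "nonres x a" "0 < a" "a < pi"
  shows "\<forall>\<^sub>F y in at x within X. count y a \<le> count x a"
proof (rule eventually_at_within_sequentiallyI)
  fix \<xi> assume \<xi>: "\<And>k. \<xi> k \<in> X - {x}" "\<xi> \<longlonglongrightarrow> x"
  then have \<xi>X: "\<And>k. \<xi> k \<in> X" by blast
  obtain r u \<theta> w \<phi> where r: "strict_mono r"
    and fr: "\<And>k. angle_frame (L (\<xi> (r k))) (M (\<xi> (r k))) (u k) (\<theta> k)"
    and frx: "angle_frame (L x) (M x) w \<phi>"
    and c: "\<And>k. count (\<xi> (r k)) a = int (card {i. 0 \<le> \<theta> k $ i})"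
      "count x a = int (card {i. 0 \<le> \<phi> $ i})" and lim: "\<And>i. (\<lambda>k. \<theta> k $ i) \<longlonglongrightarrow> \<phi> $ i"
    by (rule count_limit[OF x \<xi>X \<xi>(2)]) (rule that)
  have "\<forall>\<^sub>F k in sequentially. 0 \<le> \<theta> k $ i \<longrightarrow> 0 \<le> \<phi> $ i" for i
  proof (cases "0 \<le> \<phi> $ i")
    case False
    then have "\<phi> $ i < 0" by simp
    from order_tendstoD(2)[OF lim this] show ?thesis
      by (rule eventually_mono) simp
  qed simp
  then have "\<forall>\<^sub>F k in sequentially. \<forall>i. 0 \<le> \<theta> k $ i \<longrightarrow> 0 \<le> \<phi> $ i"
    by (simp add: eventually_all_finite)
  then obtain k where "\<And>i. 0 \<le> \<theta> k $ i \<longrightarrow> 0 \<le> \<phi> $ i"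
    using eventually_happens'[OF sequentially_bot] by blast
  then have "count (\<xi> (r k)) a \<le> count x a"
    unfolding c by (auto intro!: card_mono)
  then show "\<exists>k. count (\<xi> k) a \<le> count x a" by blast
qed

lemma eventually_count_const:
  assumes x: "x \<in> X" "nonres x a" "0 < a" "a < pi" and "nonres x 0"
  shows "\<forall>\<^sub>F y in at x within X. count y a = count x a"
proof (rule eventually_at_within_sequentiallyI)
  fix \<xi> assume \<xi>: "\<And>k. \<xi> k \<in> X - {x}" "\<xi> \<longlonglongrightarrow> x"
  then have \<xi>X: "\<And>k. \<xi> k \<in> X" by blast
  obtain r u \<theta> w \<phi> where r: "strict_mono r"
    and fr: "\<And>k. angle_frame (L (\<xi> (r k))) (M (\<xi> (r k))) (u k) (\<theta> k)"
    and frx: "angle_frame (L x) (M x) w \<phi>"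
    and c: "\<And>k. count (\<xi> (r k)) a = int (card {i. 0 \<le> \<theta> k $ i})"
      "count x a = int (card {i. 0 \<le> \<phi> $ i})" and lim: "\<And>i. (\<lambda>k. \<theta> k $ i) \<longlonglongrightarrow> \<phi> $ i"
    by (rule count_limit[OF x \<xi>X \<xi>(2)]) (rule that)
  have "\<forall>\<^sub>F k in sequentially. 0 \<le> \<theta> k $ i \<longleftrightarrow> 0 \<le> \<phi> $ i" for i
  proof (cases "0 < \<phi> $ i")
    case True
    from order_tendstoD(1)[OF lim this] True show ?thesis by (auto elim: eventually_mono)
  next
    case False
    then have "\<phi> $ i < 0" using nonres_frame[OF frx \<open>nonres x 0\<close>, of i] by simp
    from order_tendstoD(2)[OF lim this] show ?thesis
      by (rule eventually_mono) (use \<open>\<phi> $ i < 0\<close> in simp)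
  qed
  then have "\<forall>\<^sub>F k in sequentially. \<forall>i. 0 \<le> \<theta> k $ i \<longleftrightarrow> 0 \<le> \<phi> $ i"
    by (simp add: eventually_all_finite)
  then obtain k where "\<And>i. 0 \<le> \<theta> k $ i \<longleftrightarrow> 0 \<le> \<phi> $ i"
    using eventually_happens'[OF sequentially_bot] by blast
  then have "count (\<xi> (r k)) a = count x a" unfolding c by simp
  then show "\<exists>k. count (\<xi> k) a = count x a" by blast
qed

text \<open>A nearby count can be smaller only through negative angles tending to 0, and
  \<open>neg\<close> excludes these.\<close>

lemma eventually_count_ge:
  assumes x: "x \<in> X" "nonres x a" "0 < a" "a < pi"
    and neg: "\<And>\<xi> t v. (\<And>k. \<xi> k \<in> X - {x}) \<Longrightarrow> \<xi> \<longlonglongrightarrow> x \<Longrightarrow> (\<And>k. t k < 0) \<Longrightarrow> t \<longlonglongrightarrow> 0 \<Longrightarrow>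
      (\<And>k. v k \<in> angle_space (L (\<xi> k)) (M (\<xi> k)) (t k)) \<Longrightarrow> (\<And>k. norm (v k) = 1) \<Longrightarrow> False"
  shows "\<forall>\<^sub>F y in at x within X. count x a \<le> count y a"
proof (rule eventually_at_within_sequentiallyI)
  fix \<xi> assume \<xi>: "\<And>k. \<xi> k \<in> X - {x}" "\<xi> \<longlonglongrightarrow> x"
  then have \<xi>X: "\<And>k. \<xi> k \<in> X" by blast
  obtain r u \<theta> w \<phi> where r: "strict_mono r"
    and fr: "\<And>k. angle_frame (L (\<xi> (r k))) (M (\<xi> (r k))) (u k) (\<theta> k)"
    and frx: "angle_frame (L x) (M x) w \<phi>"
    and c: "\<And>k. count (\<xi> (r k)) a = int (card {i. 0 \<le> \<theta> k $ i})"
      "count x a = int (card {i. 0 \<le> \<phi> $ i})" and lim: "\<And>i. (\<lambda>k. \<theta> k $ i) \<longlonglongrightarrow> \<phi> $ i"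
    by (rule count_limit[OF x \<xi>X \<xi>(2)]) (rule that)
  have "\<forall>\<^sub>F k in sequentially. 0 \<le> \<phi> $ i \<longrightarrow> 0 \<le> \<theta> k $ i" for i
  proof (rule ccontr)
    assume "\<not> ?thesis"
    then obtain q :: "nat \<Rightarrow> nat" where q: "strict_mono q" "\<And>k. \<not> (0 \<le> \<phi> $ i \<longrightarrow> 0 \<le> \<theta> (q k) $ i)"
      using not_eventually_sequentiallyD by blast
    have lq: "(\<lambda>k. \<theta> (q k) $ i) \<longlonglongrightarrow> \<phi> $ i"
      using LIMSEQ_subseq_LIMSEQ[OF lim q(1)] by (simp add: comp_def)
    have "\<phi> $ i \<le> 0" using LIMSEQ_le_const2[OF lq, of 0] q(2) by (auto simp: not_le less_imp_le)
    then have "\<phi> $ i = 0" using q(2)[of 0] by auto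
    show False
    proof (rule neg[of "\<lambda>k. \<xi> (r (q k))" "\<lambda>k. \<theta> (q k) $ i" "\<lambda>k. u (q k) $ i"])
      show "(\<lambda>k. \<xi> (r (q k))) \<longlonglongrightarrow> x"
        using LIMSEQ_subseq_LIMSEQ[OF LIMSEQ_subseq_LIMSEQ[OF \<xi>(2) r] q(1)] by (simp add: comp_def)
      show "norm (u (q k) $ i) = 1" for k
        using fr[of "q k"] by (simp add: angle_frame_def norm_eq_sqrt_inner)
      show "(\<lambda>k. \<theta> (q k) $ i) \<longlonglongrightarrow> 0" using lq \<open>\<phi> $ i = 0\<close> by simp
    qed (use \<xi> q(2) fr in \<open>auto simp: angle_frame_def not_le\<close>)
  qed
  then have "\<forall>\<^sub>F k in sequentially. \<forall>i. 0 \<le> \<phi> $ i \<longrightarrow> 0 \<le> \<theta> k $ i"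
    by (simp add: eventually_all_finite)
  then obtain k where "\<And>i. 0 \<le> \<phi> $ i \<longrightarrow> 0 \<le> \<theta> k $ i"
    using eventually_happens'[OF sequentially_bot] by blast
  then have "count x a \<le> count (\<xi> (r k)) a"
    unfolding c by (auto intro!: card_mono)
  then show "\<exists>k. count x a \<le> count (\<xi> k) a" by blast
qed

text \<open>A frame has finitely many angles; avoiding their absolute values treats \<open>a\<close>
  and \<open>- a\<close> at once, as a Maslov partition demands.\<close>

lemma nonres_exists:
  assumes "x \<in> X"
  shows "\<exists>a. 0 < a \<and> a < pi / 2 \<and> nonres x a \<and> nonres x (- a)"
proof -
  obtain u \<theta> where fr: "angle_frame (L x) (M x) u \<theta>"
    and win: "\<And>i. - (pi / 2) < \<theta> $ i \<and> \<theta> $ i \<le> - (pi / 2) + pi"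
    using angle_frame_exists LX[OF assms] MX[OF assms] by blast
  have "infinite ({0<..<pi / 2} - range (\<lambda>i. \<bar>\<theta> $ i\<bar>))"
    by (intro Diff_infinite_finite) (auto simp: infinite_Ioo)
  then obtain a where a: "0 < a" "a < pi / 2" "\<And>i. a \<noteq> \<bar>\<theta> $ i\<bar>"
    by (metis DiffE ex_in_conv finite.emptyI greaterThanLessThan_iff rangeI)
  have "nonres x b" if "\<bar>b\<bar> = a" for b
  proof -
    have "sin (\<theta> $ i - b) \<noteq> 0" for i
    proof
      assume "sin (\<theta> $ i - b) = 0"
      moreover have "- pi < \<theta> $ i - b" "\<theta> $ i - b < pi"
        using that a(2) win[of i] by linarith+
      ultimately have "\<theta> $ i = b" using sin_eq_0_pi by fastforce
      then show False using a(3)[of i] that by simp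
    qed
    then have "dim (angle_space (L x) (M x) b) = 0"
      using dim_angle_space[OF LX[OF assms] MX[OF assms] fr, of b] by simp
    moreover have "subspace (angle_space (L x) (M x) b)"
      using assms by (intro subspace_angle_space lagrangian_subspace LX MX)
    ultimately show ?thesis
      unfolding nonres_def dim_eq_0 using subspace_0 by blast
  qed
  then show ?thesis using a by (intro exI[of _ a]) simp
qed

end

subsection \<open>The integer potential of a Lagrangian pair\<close>

text \<open>The radius \<open>\<delta>\<close> is a Lebesgue number of the cover by balls on each of
  which a single label works.\<close>

lemma compact_uniform_choice:
  fixes X :: "'x::metric_space set"
  assumes X: "compact X"
    and ex: "\<And>x. x \<in> X \<Longrightarrow> \<exists>a\<in>A. R x a"
    and open': "\<And>x a. x \<in> X \<Longrightarrow> a \<in> A \<Longrightarrow> R x a \<Longrightarrow> \<forall>\<^sub>F y in at x within X. R y a"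
  obtains \<alpha> \<delta> where "0 < \<delta>" and "\<And>x. x \<in> X \<Longrightarrow> \<alpha> x \<in> A"
    and "\<And>x y. x \<in> X \<Longrightarrow> y \<in> X \<Longrightarrow> dist x y < \<delta> \<Longrightarrow> R y (\<alpha> x)"
proof -
  have "\<exists>a r. a \<in> A \<and> r > 0 \<and> (\<forall>y\<in>X. dist y x < r \<longrightarrow> R y a)" if x: "x \<in> X" for x
  proof -
    from ex[OF x] obtain a where a: "a \<in> A" "R x a" by blast
    from open'[OF x a] obtain r where "r > 0" "\<forall>y\<in>X. y \<noteq> x \<and> dist y x < r \<longrightarrow> R y a"
      unfolding eventually_at by blast
    then show ?thesis using a by metis
  qed
  then obtain c r where c: "\<And>x. x \<in> X \<Longrightarrow> c x \<in> A" and r: "\<And>x. x \<in> X \<Longrightarrow> r x > 0"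
    and cr: "\<And>x y. x \<in> X \<Longrightarrow> y \<in> X \<Longrightarrow> dist y x < r x \<Longrightarrow> R y (c x)"
    by metis
  have "X \<subseteq> \<Union> ((\<lambda>x. ball x (r x)) ` X)" using r by fastforce
  then obtain \<delta> where \<delta>: "0 < \<delta>" "\<And>x. x \<in> X \<Longrightarrow> \<exists>G\<in>(\<lambda>x. ball x (r x)) ` X. ball x \<delta> \<subseteq> G"
    using Heine_Borel_lemma[OF X, of "(\<lambda>x. ball x (r x)) ` X"] by blast
  have "\<exists>a\<in>A. \<forall>y\<in>X. dist x y < \<delta> \<longrightarrow> R y a" if x: "x \<in> X" for x
  proof -
    from \<delta>(2)[OF x] obtain z where z: "z \<in> X" "ball x \<delta> \<subseteq> ball z (r z)" by blast
    have "R y (c z)" if "y \<in> X" "dist x y < \<delta>" for y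
      using z(2) that by (intro cr[OF z(1)]) (auto simp: dist_commute subset_iff)
    then show ?thesis using c[OF z(1)] by blast
  qed
  then show ?thesis using that[OF \<delta>(1)] by metis
qed

text \<open>The potential at \<open>x\<close> sums the increments of \<open>\<kappa>\<close> along a fine subdivision of the segment
  from a base point. As the increments between close points form a cocycle, moving the end point
  changes the sum by the increment between the end points.\<close>

lemma local_increments_potential:
  fixes X :: "'x::real_normed_vector set" and \<kappa> :: "'x \<Rightarrow> 'a \<Rightarrow> int"
  assumes X: "compact X" "convex X" "X \<noteq> {}"
    and ex: "\<And>x. x \<in> X \<Longrightarrow> \<exists>a\<in>A. R x a"
    and open': "\<And>x a. x \<in> X \<Longrightarrow> a \<in> A \<Longrightarrow> R x a \<Longrightarrow> \<forall>\<^sub>F y in at x within X. R y a"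
    and diff: "\<And>x a b. x \<in> X \<Longrightarrow> a \<in> A \<Longrightarrow> b \<in> A \<Longrightarrow> R x a \<Longrightarrow> R x b \<Longrightarrow>
      \<forall>\<^sub>F y in at x within X. \<kappa> y b - \<kappa> y a = \<kappa> x b - \<kappa> x a"
  shows "\<exists>N. \<forall>x\<in>X. \<forall>a\<in>A. R x a \<longrightarrow> (\<forall>\<^sub>F y in at x within X. N y - \<kappa> y a = N x - \<kappa> x a)"
proof -
  obtain \<alpha> \<delta> where \<delta>: "0 < \<delta>" and \<alpha>: "\<And>x. x \<in> X \<Longrightarrow> \<alpha> x \<in> A"
    and R\<alpha>: "\<And>x y. x \<in> X \<Longrightarrow> y \<in> X \<Longrightarrow> dist x y < \<delta> \<Longrightarrow> R y (\<alpha> x)"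
    by (rule compact_uniform_choice[OF X(1) ex open']) (assumption | rule that)+
  define D where "D x y = \<kappa> y (\<alpha> x) - \<kappa> x (\<alpha> x)" for x y
  \<comment> \<open>Balls are convex, so both labels are admissible along the whole segment from
    \<open>y\<close> to \<open>z\<close>. The difference of the two values of
    \<open>\<kappa>\<close> is locally constant there, hence constant.\<close>
  have agree: "\<kappa> z (\<alpha> y) - \<kappa> y (\<alpha> y) = \<kappa> z (\<alpha> x) - \<kappa> y (\<alpha> x)"
    if xyz: "x \<in> X" "y \<in> X" "z \<in> X" "dist x y < \<delta>" "dist x z < \<delta>" "dist y z < \<delta>" for x y z
  proof -
    let ?S = "closed_segment y z"
    have SX: "?S \<subseteq> X" using X(2) xyz closed_segment_subset by blast
    have "?S \<subseteq> ball x \<delta>" "?S \<subseteq> ball y \<delta>"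
      using xyz \<delta> by (simp_all add: closed_segment_subset)
    then have RS: "R w (\<alpha> x)" "R w (\<alpha> y)" if "w \<in> ?S" for w
      using that SX xyz R\<alpha> by (auto simp: mem_ball subset_iff)
    have "\<forall>w\<in>?S. \<forall>\<^sub>F v in at w within ?S. \<kappa> w (\<alpha> x) - \<kappa> w (\<alpha> y) = \<kappa> v (\<alpha> x) - \<kappa> v (\<alpha> y)"
    proof
      fix w assume w: "w \<in> ?S"
      then have "\<forall>\<^sub>F v in at w within X. \<kappa> v (\<alpha> x) - \<kappa> v (\<alpha> y) = \<kappa> w (\<alpha> x) - \<kappa> w (\<alpha> y)"
        using SX \<alpha> xyz RS by (intro diff) auto
      then have "\<forall>\<^sub>F v in at w within ?S. \<kappa> v (\<alpha> x) - \<kappa> v (\<alpha> y) = \<kappa> w (\<alpha> x) - \<kappa> w (\<alpha> y)"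
        by (rule filter_leD[OF at_le[OF SX]])
      then show "\<forall>\<^sub>F v in at w within ?S. \<kappa> w (\<alpha> x) - \<kappa> w (\<alpha> y) = \<kappa> v (\<alpha> x) - \<kappa> v (\<alpha> y)"
        by (rule eventually_mono) simp
    qed
    from connected_local_const[OF connected_segment ends_in_segment this]
    show ?thesis by simp
  qed
  have cocycle: "D x y + D y z = D x z"
    if "x \<in> X" "y \<in> X" "z \<in> X" "dist x y < \<delta>" "dist x z < \<delta>" "dist y z < \<delta>" for x y z
    using agree[OF that] by (simp add: D_def)
  obtain o' where o': "o' \<in> X" using X(3) by blast
  obtain C where C: "\<And>x. x \<in> X \<Longrightarrow> dist o' x \<le> C"
    using compact_imp_bounded[OF X(1)] bounded_any_center[of X o'] by blast
  \<comment> \<open>With \<open>m\<close> pieces, consecutive division points are less than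
    \<open>\<delta> / 3\<close> apart. Between segments with end points that close, the rungs are as
    short, so the diagonals of the cells stay below \<open>\<delta>\<close>.\<close>
  obtain m :: nat where m: "3 * C / \<delta> < m" using reals_Archimedean2 by blast
  have C0: "0 \<le> C" using C[OF o'] by simp
  then have m0: "0 < real m" using m \<delta> by (smt (verit) divide_nonneg_pos)
  define p where "p i x = o' + (real i / real m) *\<^sub>R (x - o')" for i x
  have pX: "p i x \<in> X" if "i \<le> m" "x \<in> X" for i x
  proof -
    have "p i x = (1 - real i / real m) *\<^sub>R o' + (real i / real m) *\<^sub>R x"
      by (simp add: p_def algebra_simps)
    then show ?thesis
      using convexD_alt[OF X(2) o' that(2), of "real i / real m"] that(1) m0 by simp
  qed
  have step: "dist (p i x) (p (Suc i) x) < \<delta> / 3" if "x \<in> X" for i x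
  proof -
    have "p (Suc i) x - p i x = (1 / real m) *\<^sub>R (x - o')"
      by (simp add: p_def add_divide_distrib scaleR_add_left)
    then have "dist (p i x) (p (Suc i) x) = dist o' x / m"
      using m0 by (simp add: dist_norm norm_minus_commute[of _ "p (Suc i) x"] norm_minus_commute[of o'])
    also have "\<dots> \<le> C / m" using C[OF that] m0 by (simp add: divide_right_mono)
    also have "\<dots> < \<delta> / 3" using m m0 \<delta> by (simp add: field_simps)
    finally show ?thesis .
  qed
  have close: "dist (p i x) (p i y) < \<delta> / 3" if "dist x y < \<delta> / 3" "i \<le> m" for i x y
  proof -
    have "p i x - p i y = (real i / real m) *\<^sub>R (x - y)" by (simp add: p_def algebra_simps)
    then have "dist (p i x) (p i y) = (real i / real m) * dist x y" by (simp add: dist_norm)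
    also have "\<dots> \<le> dist x y" using that(2) m0 by (intro mult_left_le_one_le) auto
    finally show ?thesis using that(1) by simp
  qed
  define N where "N x = (\<Sum>i<m. D (p i x) (p (Suc i) x))" for x
  have N: "N y - N x = D x y" if xy: "x \<in> X" "y \<in> X" "dist x y < \<delta> / 3" for x y
  proof -
    \<comment> \<open>A ladder between two segments: each cell is cut by a diagonal into two
      triangles, the cocycle identity applies to both, and only the last rung survives.\<close>
    have "(\<Sum>i<k. D (p i y) (p (Suc i) y)) - (\<Sum>i<k. D (p i x) (p (Suc i) x)) = D (p k x) (p k y)"
      if "k \<le> m" for k
      using that
    proof (induction k)
      case 0
      then show ?case by (simp add: p_def D_def)
    next
      case (Suc k)
      have X4: "p k x \<in> X" "p k y \<in> X" "p (Suc k) x \<in> X" "p (Suc k) y \<in> X"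
        using Suc.prems xy pX by auto
      have d: "dist (p k x) (p k y) < \<delta> / 3" "dist (p (Suc k) x) (p (Suc k) y) < \<delta> / 3"
        "dist (p k x) (p (Suc k) x) < \<delta> / 3" "dist (p k y) (p (Suc k) y) < \<delta> / 3"
        using close[OF xy(3)] step xy Suc.prems by auto
      have diag: "dist (p k x) (p (Suc k) y) < \<delta>"
        using dist_triangle[of "p k x" "p (Suc k) y" "p k y"] d \<delta> by linarith
      have "D (p k x) (p k y) + D (p k y) (p (Suc k) y) = D (p k x) (p (Suc k) y)"
        using d \<delta> diag by (intro cocycle X4) linarith+
      moreover have "D (p k x) (p (Suc k) x) + D (p (Suc k) x) (p (Suc k) y) = D (p k x) (p (Suc k) y)"
        using d \<delta> diag by (intro cocycle X4) linarith+
      ultimately show ?case using Suc by simp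
    qed
    from this[of m] show ?thesis using m0 by (simp add: N_def p_def)
  qed
  have "\<forall>\<^sub>F y in at x within X. N y - \<kappa> y a = N x - \<kappa> x a" if x: "x \<in> X" "a \<in> A" "R x a" for x a
  proof -
    have "\<forall>\<^sub>F y in at x within X. \<kappa> y a - \<kappa> y (\<alpha> x) = \<kappa> x a - \<kappa> x (\<alpha> x)"
      using x \<alpha> R\<alpha>[of x x] \<delta> by (intro diff) auto
    moreover have "\<forall>\<^sub>F y in at x within X. y \<in> X \<and> dist x y < \<delta> / 3"
      unfolding eventually_at using \<delta> by (intro exI[of _ "\<delta> / 3"]) (auto simp: dist_commute)
    ultimately show ?thesis
    proof eventually_elim
      case (elim y)
      then show ?case using N[OF x(1), of y] by (simp add: D_def)
    qed
  qed
  then show ?thesis by blast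
qed

text \<open>A primitive of the signed passages through 0. All labels \<open>a\<close> nonresonant at
  \<open>x\<close> prescribe the same increments near \<open>x\<close>, since their counts differ
  there by a constant.\<close>

definition maslov_potential ::
  "'x::metric_space set \<Rightarrow> ('x \<Rightarrow> (real ^ ('n::finite + 'n)) set) \<Rightarrow> ('x \<Rightarrow> (real ^ ('n + 'n)) set) \<Rightarrow>
   ('x \<Rightarrow> int) \<Rightarrow> bool" where
  "maslov_potential X L M N \<longleftrightarrow>
     (\<forall>x\<in>X. \<forall>a. 0 < a \<longrightarrow> a < pi \<longrightarrow> angle_space (L x) (M x) a = {0} \<longrightarrow>
        (\<forall>\<^sub>F y in at x within X.
           N y - int (maslov_count (L y) (M y) a) = N x - int (maslov_count (L x) (M x) a)))"

lemma maslov_potential_exists: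
  fixes X :: "'x::real_normed_vector set" and L M :: "'x \<Rightarrow> (real ^ ('n::finite + 'n)) set"
  assumes "closed_family X L" "closed_family X M" and X: "compact X" "convex X" "X \<noteq> {}"
  shows "\<exists>N. maslov_potential X L M N"
proof -
  interpret lagrangian_families X L M by standard (rule assms)+
  have "\<exists>N. \<forall>x\<in>X. \<forall>a\<in>{0<..<pi}. nonres x a \<longrightarrow>
      (\<forall>\<^sub>F y in at x within X. N y - count y a = N x - count x a)"
  proof (rule local_increments_potential[OF X])
    show "\<exists>a\<in>{0<..<pi}. nonres x a" if "x \<in> X" for x
      using nonres_exists[OF that] pi_half_less_two by (fastforce intro: less_trans)
  qed (auto intro: eventually_nonres eventually_count_diff)
  then obtain N where "\<forall>x\<in>X. \<forall>a\<in>{0<..<pi}. nonres x a \<longrightarrow>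
      (\<forall>\<^sub>F y in at x within X. N y - count y a = N x - count x a)" by blast
  then have "maslov_potential X L M N"
    by (simp add: maslov_potential_def nonres_def count_def)
  then show ?thesis by blast
qed

lemma maslov_potential_compose:
  assumes pot: "maslov_potential X L M N" and g: "continuous_on Y g" "g ` Y \<subseteq> X"
  shows "maslov_potential Y (\<lambda>y. L (g y)) (\<lambda>y. M (g y)) (\<lambda>y. N (g y))"
  unfolding maslov_potential_def
proof (intro ballI allI impI)
  fix y a assume y: "y \<in> Y" and a: "0 < a" "a < pi" "angle_space (L (g y)) (M (g y)) a = {0}"
  let ?P = "\<lambda>x. N x - int (maslov_count (L x) (M x) a) =
    N (g y) - int (maslov_count (L (g y)) (M (g y)) a)"
  have "\<forall>\<^sub>F x in at (g y) within X. ?P x"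
    using pot y a g(2) unfolding maslov_potential_def by blast
  \<comment> \<open>The filter \<open>at\<close> omits its base point, yet \<open>g\<close> may
    return to \<open>g y\<close>. Hence the passage to \<open>nhds\<close>, with the case
    \<open>g z = g y\<close> settled separately.\<close>
  then have "\<forall>\<^sub>F x in nhds (g y). x \<noteq> g y \<longrightarrow> x \<in> X \<longrightarrow> ?P x"
    by (simp add: eventually_at_filter)
  moreover have "filterlim g (nhds (g y)) (at y within Y)"
    using g(1) y by (simp add: continuous_on_def)
  ultimately have "\<forall>\<^sub>F z in at y within Y. g z \<noteq> g y \<longrightarrow> g z \<in> X \<longrightarrow> ?P (g z)"
    by (rule eventually_compose_filterlim)
  moreover have "\<forall>\<^sub>F z in at y within Y. z \<in> Y"
    by (simp add: eventually_at_filter)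
  ultimately show "\<forall>\<^sub>F z in at y within Y. ?P (g z)"
  proof eventually_elim
    case (elim z)
    then show ?case using g(2) by (cases "g z = g y") auto
  qed
qed

subsection \<open>Monotonicity along positive paths\<close>

text \<open>If angles \<open>t\<^sub>k < 0\<close> tend to \<open>0\<close> at parameters \<open>\<xi>\<^sub>k\<close> decreasing to \<open>s\<close>, with angle vectors
  \<open>v\<^sub>k \<rightarrow> u \<in> L s \<inter> K\<close>, then the isotropy of \<open>K\<close> gives \<open>J u \<bullet> v\<^sub>k = tan t\<^sub>k (u \<bullet> v\<^sub>k) < 0\<close>, whereas
  the isotropy of \<open>L \<xi>\<^sub>k\<close>, tested on the curve \<open>w\<close> through \<open>u\<close>, gives
  \<open>J u \<bullet> v\<^sub>k \<approx> (\<xi>\<^sub>k - s) (J u \<bullet> w') > 0\<close>.\<close>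

lemma no_negative_angles:
  fixes L :: "real \<Rightarrow> (real ^ ('n::finite + 'n)) set"
  assumes L: "closed_family {s..b} L" and K: "lagrangian K" and s: "s \<in> {s..b}"
    and curve: "\<And>u. u \<in> L s \<Longrightarrow> u \<in> K \<Longrightarrow> u \<noteq> 0 \<Longrightarrow>
      \<exists>w w'. w s = u \<and> (w has_vector_derivative w') (at s within {s..b}) \<and>
        (\<forall>y\<in>{s..b}. w y \<in> L y) \<and> J u \<bullet> w' > 0"
    and \<xi>: "\<And>k. \<xi> k \<in> {s..b} - {s}" "\<xi> \<longlonglongrightarrow> s" and t: "\<And>k. t k < 0" "t \<longlonglongrightarrow> 0"
    and v: "\<And>k. v k \<in> angle_space (L (\<xi> k)) K (t k)" "\<And>k. norm (v k) = 1"
  shows False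
proof -
  interpret lagrangian_families "{s..b}" L "\<lambda>_. K"
    by standard (rule L closed_family_const K)+
  have "bounded (range v)" unfolding bounded_iff using v(2) by (intro exI[of _ 1]) simp
  then obtain u r where r: "strict_mono r" "(v \<circ> r) \<longlonglongrightarrow> u"
    using bounded_imp_convergent_subsequence by blast
  define \<eta> \<tau> z where "\<eta> = \<xi> \<circ> r" and "\<tau> = t \<circ> r" and "z = v \<circ> r"
  have \<eta>: "\<And>k. s < \<eta> k" "\<And>k. \<eta> k \<in> {s..b}" "\<eta> \<longlonglongrightarrow> s"
    using \<xi> LIMSEQ_subseq_LIMSEQ[OF \<xi>(2) r(1)] by (auto simp: \<eta>_def order_less_le)
  have \<tau>: "\<And>k. \<tau> k < 0" "\<tau> \<longlonglongrightarrow> 0"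
    using t LIMSEQ_subseq_LIMSEQ[OF t(2) r(1)] by (auto simp: \<tau>_def)
  have z: "\<And>k. z k \<in> angle_space (L (\<eta> k)) K (\<tau> k)" "\<And>k. norm (z k) = 1" "z \<longlonglongrightarrow> u"
    using v r(2) by (auto simp: z_def \<eta>_def \<tau>_def)
  have "(\<lambda>k. norm (z k)) \<longlonglongrightarrow> norm u" using z(3) by (rule tendsto_norm)
  then have nu: "norm u = 1" by (simp add: z(2) LIMSEQ_const_iff)
  have "u \<in> angle_space (L s) K 0"
    by (rule angle_space_limit[OF s \<eta>(2,3) \<tau>(2) z(3,1)])
  then have u: "u \<in> L s" "u \<in> K" by (simp_all add: angle_space_def)
  have "u \<noteq> 0" using nu by auto
  from curve[OF u this] obtain w w' where w: "w s = u" "(w has_vector_derivative w') (at s within {s..b})"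
    "\<And>y. y \<in> {s..b} \<Longrightarrow> w y \<in> L y" "J u \<bullet> w' > 0" by blast
  \<comment> \<open>The remainder of the first-order expansion of \<open>w\<close> at
    \<open>s\<close>, divided by the increment.\<close>
  define e where "e k = (1 / (\<eta> k - s)) *\<^sub>R (w (\<eta> k) - (u + (\<eta> k - s) *\<^sub>R w'))" for k
  have "((\<lambda>y. (1 / norm (y - s)) *\<^sub>R (w y - (w s + (y - s) *\<^sub>R w'))) \<longlongrightarrow> 0) (at s within {s..b})"
    using w(2) by (simp add: has_vector_derivative_def has_derivative_within)
  moreover have "filterlim \<eta> (at s within {s..b}) sequentially"
    unfolding filterlim_at using \<eta>(2,3) less_imp_neq[OF \<eta>(1)] by (simp add: eq_commute)
  ultimately have "(\<lambda>k. (1 / norm (\<eta> k - s)) *\<^sub>R (w (\<eta> k) - (w s + (\<eta> k - s) *\<^sub>R w'))) \<longlonglongrightarrow> 0"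
    by (rule filterlim_compose)
  moreover have "norm (\<eta> k - s) = \<eta> k - s" for k using \<eta>(1)[of k] by simp
  ultimately have e: "e \<longlonglongrightarrow> 0" by (simp add: e_def[abs_def] w(1))
  have w\<eta>: "w (\<eta> k) = u + (\<eta> k - s) *\<^sub>R (w' + e k)" for k
    using less_imp_neq[OF \<eta>(1)[of k]] by (simp add: e_def scaleR_add_right)
  have zL: "z k \<in> L (\<eta> k)" "rot (- \<tau> k) (z k) \<in> K" for k
    using z(1)[of k] by (auto simp: angle_space_def)
  have 1: "J u \<bullet> z k = (\<eta> k - s) * - (J (w' + e k) \<bullet> z k)" for k
  proof -
    have "J (w (\<eta> k)) \<bullet> z k = 0"
      by (rule lagrangian_isotropic[OF LX[OF \<eta>(2)] w(3)[OF \<eta>(2)] zL(1)])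
    then show ?thesis
      by (simp add: w\<eta> inner_add_left del: J_linear_simps(1)) (simp add: inner_add_left algebra_simps)
  qed
  have 2: "cos (\<tau> k) * (J u \<bullet> z k) = sin (\<tau> k) * (u \<bullet> z k)" for k
    using lagrangian_isotropic[OF K u(2) zL(2)] by (simp add: rot_def inner_diff_right)
  have "(\<lambda>k. - (J (w' + e k) \<bullet> z k)) \<longlonglongrightarrow> - (J (w' + 0) \<bullet> u)"
    by (intro tendsto_intros e z(3))
  moreover have "- (J (w' + 0) \<bullet> u) > 0"
    using w(4) J_inner_left[of u w'] by (simp add: inner_commute)
  ultimately have ev1: "\<forall>\<^sub>F k in sequentially. - (J (w' + e k) \<bullet> z k) > 0"
    by (rule order_tendstoD)
  have "(\<lambda>k. u \<bullet> z k) \<longlonglongrightarrow> u \<bullet> u" by (intro tendsto_intros z(3))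
  then have ev2: "\<forall>\<^sub>F k in sequentially. u \<bullet> z k > 0"
    by (rule order_tendstoD) (use \<open>u \<noteq> 0\<close> in simp)
  have ev3: "\<forall>\<^sub>F k in sequentially. - (pi / 2) < \<tau> k"
    using \<tau>(2) by (rule order_tendstoD) simp
  from ev1 ev2 ev3 have "\<forall>\<^sub>F k in sequentially. False"
  proof eventually_elim
    case (elim k)
    have "0 < J u \<bullet> z k"
      unfolding 1 using \<eta>(1)[of k] elim(1) by (intro mult_pos_pos) simp_all
    then have "0 < cos (\<tau> k) * (J u \<bullet> z k)"
      using \<tau>(1)[of k] elim(3) by (intro mult_pos_pos cos_gt_zero_pi) auto
    moreover have "sin (\<tau> k) < 0"
      using sin_gt_zero[of "- \<tau> k"] \<tau>(1)[of k] elim(3) pi_gt_zero by simp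
    then have "sin (\<tau> k) * (u \<bullet> z k) < 0"
      using elim(2) by (rule mult_neg_pos)
    ultimately show False using 2[of k] by simp
  qed
  then show False by simp
qed

text \<open>The two sides of \<open>s\<close> differ in nature: on the left, upper semicontinuity
  alone gives \<open>N y \<le> N s\<close>; on the right, strict positivity keeps angles from
  turning negative. So a derivative from the right is all that \<open>curve\<close>
  supplies.\<close>

lemma maslov_potential_mono:
  fixes L :: "real \<Rightarrow> (real ^ ('n::finite + 'n)) set"
  assumes ab: "a \<le> b" and L: "closed_family {a..b} L" and K: "lagrangian K"
    and N: "maslov_potential {a..b} L (\<lambda>_. K) N"
    and curve: "\<And>s u. s \<in> {a..b} \<Longrightarrow> u \<in> L s \<Longrightarrow> u \<in> K \<Longrightarrow> u \<noteq> 0 \<Longrightarrow>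
      \<exists>w w'. w s = u \<and> (w has_vector_derivative w') (at s within {s..b}) \<and>
        (\<forall>y\<in>{s..b}. w y \<in> L y) \<and> J u \<bullet> w' > 0"
  shows "N a \<le> N b"
proof (rule local_mono_imp_le[OF ab])
  fix s assume s: "s \<in> {a..b}"
  interpret lagrangian_families "{a..b}" L "\<lambda>_. K"
    by standard (rule L closed_family_const K)+
  have sub: "{s..b} \<subseteq> {a..b}" using s by auto
  \<comment> \<open>Restriction to \<open>{s..b}\<close> leaves only sequences that approach
    \<open>s\<close> from the right.\<close>
  interpret R: lagrangian_families "{s..b}" L "\<lambda>_. K"
    by standard (rule closed_family_subset[OF L sub] closed_family_const K)+
  obtain c where c: "0 < c" "c < pi" "nonres s c"
    using nonres_exists[OF s] pi_gt_zero by fastforce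
  have "\<forall>\<^sub>F y in at s within {s..b}. R.count s c \<le> R.count y c"
  proof (rule R.eventually_count_ge)
    show "R.nonres s c" using c(3) by (simp add: nonres_def R.nonres_def)
  next
    fix \<xi> t v
    assume *: "\<And>k. \<xi> k \<in> {s..b} - {s}" "\<xi> \<longlonglongrightarrow> s" "\<And>k. t k < 0" "t \<longlonglongrightarrow> 0"
      "\<And>k. v k \<in> angle_space (L (\<xi> k)) K (t k)" "\<And>k. norm (v k) = 1"
    show False
      by (rule no_negative_angles[OF R.L K _ curve[OF s] *]) (use s in auto)
  qed (use s c in auto)
  then have ge: "\<forall>\<^sub>F y in at s within {a..b}. s < y \<longrightarrow> count s c \<le> count y c"
    by (auto simp: eventually_at_filter count_def R.count_def elim: eventually_mono)
  have le: "\<forall>\<^sub>F y in at s within {a..b}. count y c \<le> count s c"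
    by (rule eventually_count_le[OF s c(3,1,2)])
  have "\<forall>\<^sub>F y in at s within {a..b}. N y - count y c = N s - count s c"
    using N s c unfolding maslov_potential_def count_def nonres_def by blast
  with ge le show "\<forall>\<^sub>F y in at s within {a..b}. (y < s \<longrightarrow> N y \<le> N s) \<and> (s < y \<longrightarrow> N s \<le> N y)"
    by eventually_elim auto
qed

subsection \<open>Linear differential equations depending on a parameter\<close>

text \<open>Rescaling the variable by \<open>t\<close> fixes the interval of integration, so
  continuity of parameter integrals applies. The case \<open>t = 0\<close> is separate because the
  rescaling degenerates.\<close>

lemma continuous_on_indefinite_integral:
  fixes f :: "'p::topological_space \<Rightarrow> real \<Rightarrow> 'a::banach"
  assumes f: "continuous_on (P \<times> {0..1}) (\<lambda>(p, t). f p t)"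
  shows "continuous_on (P \<times> {0..1}) (\<lambda>(p, t). integral {0..t} (f p))"
proof -
  have "continuous_on ((P \<times> {0..1}) \<times> cbox 0 1)
      (\<lambda>(q, s). snd q *\<^sub>R (\<lambda>(p, t). f p t) (fst q, snd q * s))"
    unfolding case_prod_beta
  proof (intro continuous_intros)
    have "continuous_on ((P \<times> {0..1}) \<times> cbox 0 1)
        (\<lambda>x. (\<lambda>y. f (fst y) (snd y)) (fst (fst x), snd (fst x) * snd x))"
      using f[unfolded case_prod_beta]
      by (rule continuous_on_compose2) (auto intro!: continuous_intros simp: mult_le_one)
    then show "continuous_on ((P \<times> {0..1}) \<times> cbox 0 1)
        (\<lambda>x. f (fst (fst (fst x), snd (fst x) * snd x)) (snd (fst (fst x), snd (fst x) * snd x)))"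
      by simp
  qed
  then have "continuous_on (P \<times> {0..1})
      (\<lambda>q. integral (cbox 0 1) (\<lambda>s. snd q *\<^sub>R (\<lambda>(p, t). f p t) (fst q, snd q * s)))"
    by (rule integral_continuous_on_param)
  moreover have "integral (cbox 0 1) (\<lambda>s. snd q *\<^sub>R (\<lambda>(p, t). f p t) (fst q, snd q * s)) =
      (\<lambda>(p, t). integral {0..t} (f p)) q" if "q \<in> P \<times> {0..1}" for q
  proof (cases "snd q = 0")
    case True
    then show ?thesis by (simp add: case_prod_beta)
  next
    case False
    then have t: "0 < snd q" "snd q \<le> 1" using that by auto
    have "continuous_on {0..snd q} (\<lambda>s. (\<lambda>(p, t). f p t) (fst q, s))"
      using f by (rule continuous_on_compose2) (use that t in \<open>auto intro!: continuous_intros\<close>)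
    then have "(f (fst q) has_integral integral {0..snd q} (f (fst q))) {0..snd q}"
      by (simp add: integrable_integral integrable_continuous_real)
    from has_integral_cmul[OF has_integral_stretch_real[OF this False], of "snd q"]
    have "((\<lambda>s. snd q *\<^sub>R f (fst q) (snd q * s)) has_integral integral {0..snd q} (f (fst q)))
        ((\<lambda>x. x / snd q) ` {0..snd q})"
      using t by simp
    moreover have "(\<lambda>x. x / snd q) ` {0..snd q} = cbox 0 1"
    proof (intro set_eqI iffI)
      fix y :: real assume "y \<in> cbox 0 1"
      then have "y = (y * snd q) / snd q" "y * snd q \<in> {0..snd q}"
        using t by (simp_all add: mult_le_cancel_right1)
      then show "y \<in> (\<lambda>x. x / snd q) ` {0..snd q}" by blast
    qed (use t in auto)
    ultimately have "((\<lambda>s. snd q *\<^sub>R f (fst q) (snd q * s)) has_integral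
        integral {0..snd q} (f (fst q))) (cbox 0 1)" by simp
    from integral_unique[OF this] show ?thesis
      by (simp only: case_prod_beta fst_conv snd_conv)
  qed
  ultimately show ?thesis
    using continuous_on_cong[OF refl, of "P \<times> {0..1}"] by (simp cong: continuous_on_cong)
qed

text \<open>The iterated integrals of the Dyson series; their partial sums are the Picard iterates
  for \<open>\<Psi>' = B \<Psi>\<close> with initial value the identity.\<close>

primrec dyson_term :: "('p \<Rightarrow> real \<Rightarrow> 'e::banach \<Rightarrow>\<^sub>L 'e) \<Rightarrow> nat \<Rightarrow> 'p \<Rightarrow> real \<Rightarrow> 'e \<Rightarrow>\<^sub>L 'e" where
  "dyson_term B 0 = (\<lambda>p t. id_blinfun)"
| "dyson_term B (Suc k) = (\<lambda>p t. integral {0..t} (\<lambda>s. B p s o\<^sub>L dyson_term B k p s))"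

text \<open>Compactness of \<open>P\<close> yields one bound \<open>C\<close>, so the factorial
  estimate is uniform in \<open>p\<close> and \<open>t\<close>. Uniform convergence gives joint
  continuity and permits the limit in the integral equation, which is then differentiated.\<close>

lemma linear_ode_solution:
  fixes B :: "'p::metric_space \<Rightarrow> real \<Rightarrow> 'e::banach \<Rightarrow>\<^sub>L 'e"
  assumes P: "compact P" and B: "continuous_on (P \<times> {0..1}) (\<lambda>(p, t). B p t)"
  obtains \<Psi> where "continuous_on (P \<times> {0..1}) (\<lambda>(p, t). \<Psi> p t)"
    and "\<And>p. p \<in> P \<Longrightarrow> \<Psi> p 0 = id_blinfun"
    and "\<And>p t. p \<in> P \<Longrightarrow> t \<in> {0..1} \<Longrightarrow>
      (\<Psi> p has_vector_derivative (B p t o\<^sub>L \<Psi> p t)) (at t within {0..1})"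
proof -
  let ?K = "P \<times> {0..1::real}"
  let ?\<Phi> = "dyson_term B"
  have K: "compact ?K" using P by (simp add: compact_Times)
  have "bounded ((\<lambda>(p, t). B p t) ` ?K)"
    using B K compact_continuous_image compact_imp_bounded by blast
  then obtain C where C: "C > 0" "\<And>p t. p \<in> P \<Longrightarrow> t \<in> {0..1} \<Longrightarrow> norm (B p t) \<le> C"
    unfolding bounded_pos by auto
  have comp: "continuous_on ?K (\<lambda>(p, t). B p t o\<^sub>L F p t)" if "continuous_on ?K (\<lambda>(p, t). F p t)"
    for F :: "'p \<Rightarrow> real \<Rightarrow> 'e \<Rightarrow>\<^sub>L 'e"
    using bounded_bilinear.continuous_on[OF bounded_bilinear_blinfun_compose B that]
    by (simp add: case_prod_beta)
  have \<Phi>: "continuous_on ?K (\<lambda>(p, t). ?\<Phi> k p t)" for k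
  proof (induction k)
    case (Suc k)
    from continuous_on_indefinite_integral[OF comp[OF this]] show ?case by simp
  qed (simp add: case_prod_beta)
  have slice: "continuous_on {0..b} (F p)"
    if "continuous_on ?K (\<lambda>(p, t). F p t)" "p \<in> P" "b \<le> 1" for F :: "'p \<Rightarrow> real \<Rightarrow> 'e \<Rightarrow>\<^sub>L 'e" and p b
  proof -
    have "continuous_on {0..b} (\<lambda>t. (\<lambda>(p, t). F p t) (p, t))"
      using that(1) by (rule continuous_on_compose2) (use that in \<open>auto intro!: continuous_intros\<close>)
    then show ?thesis by simp
  qed
  have bound: "norm (?\<Phi> k p t) \<le> (C * t) ^ k / fact k" if "p \<in> P" "t \<in> {0..1}" for k p t
    using that
  proof (induction k arbitrary: t)
    case 0
    then show ?case by (simp add: norm_blinfun_id_le)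
  next
    case (Suc k)
    have "((\<lambda>s. C * ((C * s) ^ k / fact k)) has_integral
        ((C * t) ^ Suc k / fact (Suc k) - (C * 0) ^ Suc k / fact (Suc k))) {0..t}"
    proof (rule fundamental_theorem_of_calculus)
      fix s assume "s \<in> {0..t}"
      have "((\<lambda>s. (C * s) ^ Suc k / fact (Suc k)) has_real_derivative
          (real (Suc k) * (C * (C * s) ^ k)) / fact (Suc k)) (at s within {0..t})"
        using DERIV_cdivide[OF DERIV_power[OF DERIV_cmult_Id], of C "Suc k" "fact (Suc k)" s "{0..t}"] by simp
      moreover have "(real (Suc k) * (C * (C * s) ^ k)) / fact (Suc k) = C * ((C * s) ^ k / fact k)"
        by (simp add: divide_simps)
      ultimately show "((\<lambda>s. (C * s) ^ Suc k / fact (Suc k)) has_vector_derivative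
          C * ((C * s) ^ k / fact k)) (at s within {0..t})"
        by (simp only: has_real_derivative_iff_has_vector_derivative)
    qed (use Suc.prems in simp)
    then have I: "((\<lambda>s. C * ((C * s) ^ k / fact k)) has_integral (C * t) ^ Suc k / fact (Suc k)) {0..t}"
      by simp
    have "norm (integral {0..t} (\<lambda>s. B p s o\<^sub>L ?\<Phi> k p s)) \<le>
        integral {0..t} (\<lambda>s. C * ((C * s) ^ k / fact k))"
    proof (rule integral_norm_bound_integral)
      show "(\<lambda>s. B p s o\<^sub>L ?\<Phi> k p s) integrable_on {0..t}"
        using slice[OF comp[OF \<Phi>], of p t] Suc.prems by (simp add: integrable_continuous_real)
      show "(\<lambda>s. C * ((C * s) ^ k / fact k)) integrable_on {0..t}" using I by blast
      fix s assume "s \<in> {0..t}"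
      then have s: "s \<in> {0..1}" using Suc.prems by auto
      have "norm (B p s o\<^sub>L ?\<Phi> k p s) \<le> norm (B p s) * norm (?\<Phi> k p s)"
        by (rule norm_blinfun_compose)
      also have "\<dots> \<le> C * ((C * s) ^ k / fact k)"
        using Suc.IH[OF Suc.prems(1) s] C Suc.prems(1) s by (intro mult_mono) auto
      finally show "norm (B p s o\<^sub>L ?\<Phi> k p s) \<le> C * ((C * s) ^ k / fact k)" .
    qed
    then show ?case by (simp only: integral_unique[OF I] dyson_term.simps)
  qed
  define \<Psi> where "\<Psi> p t = (\<Sum>k. ?\<Phi> k p t)" for p t
  have unif: "uniform_limit ?K (\<lambda>n (p, t). \<Sum>k<n. ?\<Phi> k p t) (\<lambda>(p, t). \<Psi> p t) sequentially"
  proof -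
    have "uniform_limit ?K (\<lambda>n q. \<Sum>k<n. ?\<Phi> k (fst q) (snd q)) (\<lambda>q. \<Sum>k. ?\<Phi> k (fst q) (snd q)) sequentially"
    proof (rule Weierstrass_m_test)
      fix k q assume q: "q \<in> ?K"
      then have "norm (?\<Phi> k (fst q) (snd q)) \<le> (C * snd q) ^ k / fact k"
        by (intro bound) auto
      also have "\<dots> \<le> C ^ k / fact k"
        using q C(1) by (intro divide_right_mono power_mono) (auto simp: mult_le_cancel_left1)
      finally show "norm (?\<Phi> k (fst q) (snd q)) \<le> C ^ k / fact k" .
    next
      show "summable (\<lambda>k. C ^ k / fact k)"
        using summable_exp[of C] by (simp add: field_simps)
    qed
    then show ?thesis by (simp add: \<Psi>_def case_prod_unfold)
  qed
  have sums: "continuous_on ?K (\<lambda>(p, t). \<Sum>k<n. ?\<Phi> k p t)" for n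
    using \<Phi> by (auto simp: case_prod_unfold intro!: continuous_intros)
  have \<Psi>: "continuous_on ?K (\<lambda>(p, t). \<Psi> p t)"
    by (rule uniform_limit_theorem[OF _ unif]) (use sums in \<open>auto intro: always_eventually\<close>)
  have integral_eq: "\<Psi> p t = id_blinfun + integral {0..t} (\<lambda>s. B p s o\<^sub>L \<Psi> p s)"
    if p: "p \<in> P" and t: "t \<in> {0..1}" for p t
  proof -
    have K': "(\<lambda>s. (p, s)) \<in> {0..t} \<rightarrow> ?K" using p t by auto
    have u: "uniform_limit {0..t} (\<lambda>n s. B p s o\<^sub>L (\<Sum>k<n. ?\<Phi> k p s)) (\<lambda>s. B p s o\<^sub>L \<Psi> p s) sequentially"
    proof (rule bounded_bilinear.bounded_uniform_limit[OF bounded_bilinear_blinfun_compose])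
      show "uniform_limit {0..t} (\<lambda>n s. \<Sum>k<n. ?\<Phi> k p s) (\<Psi> p) sequentially"
        using uniform_limit_compose'[OF unif K'] by simp
      show "bounded (B p ` {0..t})" "bounded (\<Psi> p ` {0..t})"
        using slice[OF B p] slice[OF \<Psi> p] t by (auto intro!: compact_imp_bounded compact_continuous_image)
    qed (rule uniform_limit_const)
    have c: "continuous_on {0..t} (\<lambda>s. B p s o\<^sub>L (\<Sum>k<n. ?\<Phi> k p s))" for n
      using slice[OF comp[OF sums]] p t by simp
    obtain I J where IJ: "\<And>n. ((\<lambda>s. B p s o\<^sub>L (\<Sum>k<n. ?\<Phi> k p s)) has_integral I n) {0..t}"
      "((\<lambda>s. B p s o\<^sub>L \<Psi> p s) has_integral J) {0..t}" "I \<longlonglongrightarrow> J"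
      by (rule uniform_limit_integral[OF u c]) auto
    \<comment> \<open>Integrating the first \<open>n\<close> terms produces the terms 1 to
      \<open>n\<close>; the identity is term 0.\<close>
    have "(\<Sum>k<Suc n. ?\<Phi> k p t) = id_blinfun + I n" for n
    proof -
      have "I n = integral {0..t} (\<lambda>s. \<Sum>k<n. B p s o\<^sub>L ?\<Phi> k p s)"
        using integral_unique[OF IJ(1)[of n]]
        by (simp add: bounded_bilinear.sum_right[OF bounded_bilinear_blinfun_compose])
      also have "\<dots> = (\<Sum>k<n. integral {0..t} (\<lambda>s. B p s o\<^sub>L ?\<Phi> k p s))"
        using slice[OF comp[OF \<Phi>], of p t] p t
        by (intro integral_sum) (auto intro: integrable_continuous_real)
      finally show ?thesis by (simp add: sum.lessThan_Suc_shift del: sum.lessThan_Suc)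
    qed
    moreover have "(\<lambda>n. \<Sum>k<n. ?\<Phi> k p t) \<longlonglongrightarrow> \<Psi> p t"
      using tendsto_uniform_limitI[OF unif, of "(p, t)"] p t by simp
    then have "(\<lambda>n. \<Sum>k<Suc n. ?\<Phi> k p t) \<longlonglongrightarrow> \<Psi> p t"
      by (rule LIMSEQ_Suc)
    ultimately have "(\<lambda>n. id_blinfun + I n) \<longlonglongrightarrow> \<Psi> p t" by (simp only:)
    moreover have "(\<lambda>n. id_blinfun + I n) \<longlonglongrightarrow> id_blinfun + J"
      using IJ(3) by (intro tendsto_intros)
    ultimately show ?thesis
      using LIMSEQ_unique integral_unique[OF IJ(2)] by blast
  qed
  show ?thesis
  proof (rule that[OF \<Psi>])
    show "\<Psi> p 0 = id_blinfun" if "p \<in> P" for p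
      using integral_eq[OF that, of 0] by simp
  next
    fix p t assume p: "p \<in> P" and t: "t \<in> {0..1::real}"
    have "((\<lambda>t. id_blinfun + integral {0..t} (\<lambda>s. B p s o\<^sub>L \<Psi> p s)) has_vector_derivative
        (0 + (B p t o\<^sub>L \<Psi> p t))) (at t within {0..1})"
      using slice[OF comp[OF \<Psi>] p, of 1] t
      by (intro has_vector_derivative_add integral_has_vector_derivative has_vector_derivative_const) auto
    from has_vector_derivative_transform[OF t _ this, of "\<Psi> p"]
    show "(\<Psi> p has_vector_derivative (B p t o\<^sub>L \<Psi> p t)) (at t within {0..1})"
      using integral_eq[OF p] by simp
  qed
qed

subsection \<open>Closed families from paths and from symplectic maps\<close>

lemma closest_point_eq_iff_subspace:
  fixes K :: "(real ^ 'm::finite) set"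
  assumes "subspace K" "p \<in> K" "x - p \<in> K\<^sup>\<bottom>"
  shows "closest_point K x = p"
proof -
  let ?c = "closest_point K x"
  have "?c - p \<in> K" using closest_point_subspace(1)[OF assms(1)] assms by (simp add: subspace_diff)
  moreover have "?c - p \<in> K\<^sup>\<bottom>"
    using subspace_diff[OF subspace_orthogonal_comp assms(3) closest_point_subspace(2)[OF assms(1), of x]]
    by simp
  ultimately have "orthogonal (?c - p) (?c - p)" by (auto simp: orthogonal_comp_def)
  then show ?thesis by (simp add: orthogonal_self)
qed

lemma orth_projector_vector_mult:
  fixes K :: "(real ^ 'm::finite) set"
  assumes "subspace K"
  shows "orth_projector K *v x = closest_point K x"
proof -
  note cp = closest_point_subspace[OF assms] and sub = subspace_orthogonal_comp[of K]
  have "linear (closest_point K)"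
  proof (rule linearI)
    fix x y
    have "(x - closest_point K x) + (y - closest_point K y) \<in> K\<^sup>\<bottom>"
      using cp(2) sub by (simp add: subspace_add)
    then show "closest_point K (x + y) = closest_point K x + closest_point K y"
      using cp(1) assms by (intro closest_point_eq_iff_subspace) (simp_all add: subspace_add algebra_simps)
  next
    fix c x
    have "c *\<^sub>R (x - closest_point K x) \<in> K\<^sup>\<bottom>"
      using cp(2) sub by (simp add: subspace_mul)
    then show "closest_point K (c *\<^sub>R x) = c *\<^sub>R closest_point K x"
      using cp(1) assms by (intro closest_point_eq_iff_subspace) (simp_all add: subspace_mul algebra_simps)
  qed
  then show ?thesis by (simp add: orth_projector_def matrix_works)
qed

lemma tendsto_matrix_vector_mult:
  fixes A :: "'a \<Rightarrow> real ^ 'n::finite ^ 'm::finite"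
  assumes "(A \<longlongrightarrow> B) F" "(v \<longlongrightarrow> w) F"
  shows "((\<lambda>x. A x *v v x) \<longlongrightarrow> B *v w) F"
  unfolding matrix_vector_mult_def
  by (intro tendsto_vec_lambda tendsto_sum tendsto_mult tendsto_vec_nth assms)

text \<open>A vector belongs to a subspace exactly when the projector fixes it, and this equation
  survives the limit when the projectors converge.\<close>

lemma lagrangian_path_closed_family:
  assumes "lagrangian_path L"
  shows "closed_family {0..1} L"
proof -
  have cm: "continuous_map (top_of_set {0..1}) (grassmann_topology CARD('a)) L"
    and lag: "L \<in> topspace (top_of_set {0..1}) \<rightarrow> Collect lagrangian"
    using assms unfolding lagrangian_path_def lagrangian_topology_def continuous_map_in_subtopology
    by blast+
  have "continuous_map (grassmann_topology CARD('a)) euclidean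
      (id \<circ> (orth_projector :: (real ^ ('a + 'a)) set \<Rightarrow> _))"
    unfolding grassmann_topology_def by (rule continuous_map_pullback) simp
  from continuous_map_compose[OF cm this]
  have cont: "continuous_on {0..1} (\<lambda>x. orth_projector (L x))"
    by (simp add: comp_def continuous_map_iff_continuous2)
  have L: "lagrangian (L x)" if "x \<in> {0..1}" for x using lag that by auto
  show ?thesis
    unfolding closed_family_def
  proof (intro conjI ballI allI impI)
    fix \<xi> x v w
    assume h: "\<forall>k. \<xi> k \<in> {0..1} \<and> v k \<in> L (\<xi> k)" "\<xi> \<longlonglongrightarrow> x" "x \<in> {0..1}" "v \<longlonglongrightarrow> w"
    have "(\<lambda>k. orth_projector (L (\<xi> k))) \<longlonglongrightarrow> orth_projector (L x)"
      by (rule continuous_on_tendsto_compose[OF cont h(2,3)]) (use h(1) in simp)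
    from tendsto_matrix_vector_mult[OF this h(4)]
    have "(\<lambda>k. orth_projector (L (\<xi> k)) *v v k) \<longlonglongrightarrow> orth_projector (L x) *v w" .
    moreover have "orth_projector (L (\<xi> k)) *v v k = v k" for k
      using h(1) L by (simp add: orth_projector_vector_mult lagrangian_subspace closest_point_self)
    ultimately have "orth_projector (L x) *v w = w"
      using h(4) LIMSEQ_unique by fastforce
    then show "w \<in> L x"
      using closest_point_subspace(1)[of "L x" w] L[OF h(3)]
      by (simp add: orth_projector_vector_mult lagrangian_subspace)
  qed (rule L)
qed

section \<open>Symplectic maps and the Hamiltonian flow\<close>

definition symplectic :: "(real ^ ('n::finite + 'n) \<Rightarrow> real ^ ('n + 'n)) \<Rightarrow> bool" where
  "symplectic g \<longleftrightarrow> linear g \<and> (\<forall>u v. J (g u) \<bullet> g v = J u \<bullet> v)"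

text \<open>With \<open>g'\<close> the adjoint, invariance of the form reads
  \<open>g' J g = J\<close>, so \<open>- J g' J\<close> inverts \<open>g\<close>.\<close>

lemma symplectic_left_inverse:
  assumes "symplectic g"
  shows "- J (adjoint g (J (g u))) = u"
proof -
  have g: "linear g" "\<And>u v. J (g u) \<bullet> g v = J u \<bullet> v" using assms by (auto simp: symplectic_def)
  have "adjoint g (J (g u)) \<bullet> v = J u \<bullet> v" for v
    using adjoint_works[OF g(1), of v "J (g u)"] g(2)[of u v] by (simp add: inner_commute)
  then have "adjoint g (J (g u)) = J u"
    using vector_eq_rdot by blast
  then show ?thesis by simp
qed

lemma symplectic_image_lagrangian:
  assumes g: "symplectic g" and L: "lagrangian L"
  shows "lagrangian (g ` L)"
proof (rule lagrangianI)
  have lin: "linear g" using g by (simp add: symplectic_def)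
  show "subspace (g ` L)" by (rule linear_subspace_image[OF lin lagrangian_subspace[OF L]])
  show "J u \<bullet> v = 0" if "u \<in> g ` L" "v \<in> g ` L" for u v
    using that g lagrangian_isotropic[OF L] by (auto simp: symplectic_def)
  fix w assume w: "\<And>v. v \<in> g ` L \<Longrightarrow> w \<bullet> v = 0"
  have "inj g" by (rule inj_on_inverseI[where g = "\<lambda>y. - J (adjoint g (J y))"])
      (rule symplectic_left_inverse[OF g])
  then have "surj g" using lin linear_injective_imp_surjective by blast
  then obtain x where x: "J w = g x" by (metis surjD)
  have "adjoint g w \<bullet> v = 0" if "v \<in> L" for v
    using adjoint_works[OF lin, of v w] w[of "g v"] that by (simp add: inner_commute)
  then have "J (adjoint g w) \<in> L" by (rule lagrangian_maximal[OF L])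
  moreover have "J (adjoint g w) = x"
  proof -
    have "J (g x) = - w" by (simp flip: x)
    then show ?thesis
      using symplectic_left_inverse[OF g, of x]
      by (simp add: linear_neg[OF adjoint_linear[OF lin]])
  qed
  ultimately show "J w \<in> g ` L" using x by blast
qed

text \<open>The difficulty is convergence of the preimages \<open>z k\<close>. Invariance of the
  form turns \<open>J (z k) \<bullet> e\<close> into \<open>J (v k) \<bullet> G (\<xi> k) e\<close>,
  in which every factor converges.\<close>

lemma closed_family_symplectic_image:
  fixes L :: "'x::metric_space \<Rightarrow> (real ^ ('n::finite + 'n)) set"
  assumes L: "closed_family X L" and G: "\<And>x. x \<in> X \<Longrightarrow> symplectic (G x)"
    and cont: "\<And>x \<xi> v w. x \<in> X \<Longrightarrow> (\<And>k. \<xi> k \<in> X) \<Longrightarrow> \<xi> \<longlonglongrightarrow> x \<Longrightarrow> v \<longlonglongrightarrow> w \<Longrightarrow>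
      (\<lambda>k. G (\<xi> k) (v k)) \<longlonglongrightarrow> G x w"
  shows "closed_family X (\<lambda>x. G x ` L x)"
  unfolding closed_family_def
proof (intro conjI ballI allI impI)
  show "lagrangian (G x ` L x)" if "x \<in> X" for x
    by (rule symplectic_image_lagrangian[OF G[OF that] closed_family_lagrangian[OF L that]])
next
  fix \<xi> x v w
  assume h: "\<forall>k. \<xi> k \<in> X \<and> v k \<in> G (\<xi> k) ` L (\<xi> k)" "\<xi> \<longlonglongrightarrow> x" "x \<in> X" "v \<longlonglongrightarrow> w"
  then have "\<forall>k. \<exists>z. z \<in> L (\<xi> k) \<and> v k = G (\<xi> k) z" by blast
  then obtain z where z: "\<And>k. z k \<in> L (\<xi> k)" "\<And>k. v k = G (\<xi> k) (z k)" by metis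
  have \<xi>: "\<xi> k \<in> X" for k using h(1) by blast
  have lin: "linear (G x)" using G[OF h(3)] by (simp add: symplectic_def)
  have "(\<lambda>k. J (z k)) \<longlonglongrightarrow> adjoint (G x) (J w)"
    unfolding tendsto_componentwise_iff[of "\<lambda>k. J (z k)"]
  proof
    fix e
    have "(\<lambda>k. J (v k) \<bullet> G (\<xi> k) e) \<longlonglongrightarrow> J w \<bullet> G x e"
      by (intro tendsto_inner tendsto_J h(4) cont[OF h(3) \<xi> h(2)] tendsto_const)
    moreover have "J (v k) \<bullet> G (\<xi> k) e = J (z k) \<bullet> e" for k
      using G[OF \<xi>[of k]] by (simp add: z(2) symplectic_def)
    moreover have "J w \<bullet> G x e = adjoint (G x) (J w) \<bullet> e"
      using adjoint_works[OF lin, of e "J w"] by (simp add: inner_commute)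
    ultimately show "(\<lambda>k. J (z k) \<bullet> e) \<longlonglongrightarrow> adjoint (G x) (J w) \<bullet> e" by simp
  qed
  then have "(\<lambda>k. - J (J (z k))) \<longlonglongrightarrow> - J (adjoint (G x) (J w))"
    by (intro tendsto_minus tendsto_J)
  then have zl: "z \<longlonglongrightarrow> - J (adjoint (G x) (J w))" by simp
  have "- J (adjoint (G x) (J w)) \<in> L x"
    by (rule closed_family_limit[OF L h(3) \<xi> z(1) h(2) zl])
  moreover have "v \<longlonglongrightarrow> G x (- J (adjoint (G x) (J w)))"
    using cont[OF h(3) \<xi> h(2) zl] by (simp flip: z(2))
  then have "w = G x (- J (adjoint (G x) (J w)))"
    using h(4) LIMSEQ_unique by blast
  ultimately show "w \<in> G x ` L x" by blast
qed

text \<open>Symmetry of \<open>S l t\<close> makes the symplectic form of two solutions constant in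
  time, and at time 0 the flow is the identity.\<close>

lemma hamiltonian_flow:
  fixes S :: "real \<Rightarrow> real \<Rightarrow> real ^ ('n::finite + 'n) ^ ('n + 'n)"
  assumes S: "continuous_on ({0..1} \<times> {0..1}) (\<lambda>(l, t). S l t)"
    and sym: "\<And>l t. l \<in> {0..1} \<Longrightarrow> t \<in> {0..1} \<Longrightarrow> transpose (S l t) = S l t"
  obtains \<Psi> :: "real \<Rightarrow> real \<Rightarrow> (real ^ ('n + 'n)) \<Rightarrow>\<^sub>L (real ^ ('n + 'n))"
  where "continuous_on ({0..1} \<times> {0..1}) (\<lambda>(l, t). \<Psi> l t)"
    and "\<And>l. l \<in> {0..1} \<Longrightarrow> \<Psi> l 0 = id_blinfun"
    and "\<And>l t u. l \<in> {0..1} \<Longrightarrow> t \<in> {0..1} \<Longrightarrow>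
      ((\<lambda>t. \<Psi> l t u) has_vector_derivative J (S l t *v \<Psi> l t u)) (at t within {0..1})"
    and "\<And>l t. l \<in> {0..1} \<Longrightarrow> t \<in> {0..1} \<Longrightarrow> symplectic (\<Psi> l t)"
proof -
  define B where "B l t = Blinfun (\<lambda>v. J (S l t *v v))" for l t
  have "bounded_linear (\<lambda>v. J (A *v v))" for A :: "real ^ ('n + 'n) ^ ('n + 'n)"
    unfolding matrix_vector_mul_assoc by (rule matrix_vector_mul_bounded_linear)
  then have Bv: "B l t v = J (S l t *v v)" for l t v
    by (simp add: B_def bounded_linear_Blinfun_apply)
  have "continuous_on ({0..1} \<times> {0..1}) (\<lambda>q. B (fst q) (snd q))"
  proof (rule continuous_on_blinfun_componentwise)
    fix i :: "real ^ ('n + 'n)"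
    show "continuous_on ({0..1} \<times> {0..1}) (\<lambda>q. B (fst q) (snd q) i)"
      using S unfolding Bv continuous_on_def case_prod_unfold
      by (auto intro!: tendsto_J tendsto_matrix_vector_mult)
  qed
  then have "continuous_on ({0..1} \<times> {0..1}) (\<lambda>(l, t). B l t)"
    by (simp add: case_prod_unfold)
  then obtain \<Psi> where \<Psi>: "continuous_on ({0..1} \<times> {0..1}) (\<lambda>(l, t). \<Psi> l t)"
      "\<And>l. l \<in> {0..1} \<Longrightarrow> \<Psi> l 0 = id_blinfun"
    and d: "\<And>l t. l \<in> {0..1} \<Longrightarrow> t \<in> {0..1} \<Longrightarrow>
      (\<Psi> l has_vector_derivative (B l t o\<^sub>L \<Psi> l t)) (at t within {0..1})"
    using linear_ode_solution[of "{0..1}" B] compact_Icc by metis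
  have dv: "((\<lambda>t. \<Psi> l t u) has_vector_derivative J (S l t *v \<Psi> l t u)) (at t within {0..1})"
    if "l \<in> {0..1}" "t \<in> {0..1}" for l t u
    using bounded_linear.has_vector_derivative[OF blinfun.bounded_linear_left d[OF that], of u]
    by (simp add: Bv)
  have "symplectic (\<Psi> l t)" if l: "l \<in> {0..1}" and t: "t \<in> {0..1}" for l t
    unfolding symplectic_def
  proof (intro conjI allI)
    show "linear (\<Psi> l t)" by (rule bounded_linear.linear[OF blinfun.bounded_linear_right])
    fix u v
    have const: "((\<lambda>t. J (\<Psi> l t u) \<bullet> \<Psi> l t v) has_vector_derivative 0) (at s within {0..1})"
      if s: "s \<in> {0..1}" for s
    proof -
      have "((\<lambda>t. J (\<Psi> l t u)) has_vector_derivative J (J (S l s *v \<Psi> l s u))) (at s within {0..1})"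
        by (rule bounded_linear.has_vector_derivative[OF matrix_vector_mul_bounded_linear dv[OF l s]])
      from bounded_bilinear.has_vector_derivative[OF bounded_bilinear_inner this dv[OF l s, of v]]
      have "((\<lambda>t. J (\<Psi> l t u) \<bullet> \<Psi> l t v) has_vector_derivative
          (\<Psi> l s u \<bullet> (S l s *v \<Psi> l s v) - (S l s *v \<Psi> l s u) \<bullet> \<Psi> l s v)) (at s within {0..1})"
        by simp
      moreover have "(S l s *v x) \<bullet> y = x \<bullet> (S l s *v y)" for x y
        using dot_lmul_matrix[of x "S l s" y] sym[OF l s] by (metis vector_transpose_matrix)
      ultimately show ?thesis by simp
    qed
    obtain c where c: "\<And>s. s \<in> {0..1} \<Longrightarrow> J (\<Psi> l s u) \<bullet> \<Psi> l s v = c"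
      using has_vector_derivative_zero_constant[OF convex_real_interval(5) const] by blast
    show "J (\<Psi> l t u) \<bullet> \<Psi> l t v = J u \<bullet> v"
      using c[OF t] c[of 0] \<Psi>(2)[OF l] by simp
  qed
  then show ?thesis using that[OF \<Psi> dv] by blast
qed

subsection \<open>The Maslov index and the crossings of a path\<close>

lemma maslov_potential_eventually_le:
  assumes "closed_family X L" "closed_family X M" "maslov_potential X L M N" and x: "x \<in> X"
  shows "\<forall>\<^sub>F y in at x within X. N y \<le> N x"
proof -
  interpret lagrangian_families X L M by standard (rule assms)+
  obtain c where c: "0 < c" "c < pi" "nonres x c"
    using nonres_exists[OF x] pi_gt_zero by fastforce
  have "\<forall>\<^sub>F y in at x within X. N y - count y c = N x - count x c"
    using assms(3) x c unfolding maslov_potential_def count_def nonres_def by blast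
  with eventually_count_le[OF x c(3,1,2)] show ?thesis
    by eventually_elim simp
qed

text \<open>On each piece \<open>N\<close> minus the count for \<open>a i\<close> is constant, so
  every admissible sum telescopes to the same value: this is uniqueness for the description.
  Existence comes from a mesh below the uniform radius \<open>\<delta>\<close>.\<close>

lemma maslov_index_eq_potential:
  fixes L M :: "real \<Rightarrow> (real ^ ('n::finite + 'n)) set"
  assumes "closed_family {0..1} L" "closed_family {0..1} M" and N: "maslov_potential {0..1} L M N"
  shows "maslov_index L M = N 1 - N 0"
proof -
  interpret lagrangian_families "{0..1}" L M by standard (rule assms)+
  have sum: "maslov_sum L M m p a = N 1 - N 0" if part: "maslov_partition L M m p a" for m p a
  proof -
    have p: "p 0 = 0" "p m = 1" "\<And>i. i \<in> {1..m} \<Longrightarrow> p (i - 1) < p i"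
      and a: "\<And>i. i \<in> {1..m} \<Longrightarrow> 0 < a i \<and> a i < pi / 2"
      and nr: "\<And>i l. i \<in> {1..m} \<Longrightarrow> l \<in> {p (i - 1)..p i} \<Longrightarrow> nonres l (a i)"
      using part unfolding maslov_partition_def nonres_def rot_inter_trivial_iff by blast+
    have mono: "p i \<le> p j" if "i \<le> j" "j \<le> m" for i j
      using that
    proof (induction rule: dec_induct)
      case (step k)
      then show ?case using p(3)[of "Suc k"] by simp
    qed simp
    have step: "count (p i) (a i) - count (p (i - 1)) (a i) = N (p i) - N (p (i - 1))"
      if i: "i \<in> {1..m}" for i
    proof -
      let ?I = "{p (i - 1)..p i}"
      have sub: "?I \<subseteq> {0..1}"
        using mono[of 0 "i - 1"] mono[of i m] i p by auto
      have "\<forall>l\<in>?I. \<forall>\<^sub>F y in at l within ?I. N l - count l (a i) = N y - count y (a i)"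
      proof
        fix l assume l: "l \<in> ?I"
        have "a i < pi" using a[OF i] pi_gt_zero by simp
        then have "\<forall>\<^sub>F y in at l within {0..1}. N y - count y (a i) = N l - count l (a i)"
          using N l sub nr[OF i l] a[OF i] unfolding maslov_potential_def count_def nonres_def by blast
        then have "\<forall>\<^sub>F y in at l within ?I. N y - count y (a i) = N l - count l (a i)"
          by (rule filter_leD[OF at_le[OF sub]])
        then show "\<forall>\<^sub>F y in at l within ?I. N l - count l (a i) = N y - count y (a i)"
          by (rule eventually_mono) simp
      qed
      from connected_local_const[OF connected_Icc _ _ this, of "p (i - 1)" "p i"] p(3)[OF i]
      show ?thesis by simp
    qed
    have "maslov_sum L M m p a = (\<Sum>i=1..m. N (p i) - N (p (i - 1)))"
      unfolding maslov_sum_def using step by (intro sum.cong) (auto simp: count_def)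
    also have "\<dots> = N (p m) - N (p 0)"
      using sum_telescope''[of 0 m "\<lambda>i. N (p i)"] by simp
    finally show ?thesis using p by simp
  qed
  obtain m p a where part: "maslov_partition L M m p a"
  proof -
    have ex: "\<exists>a\<in>{0<..<pi / 2}. nonres x a \<and> nonres x (- a)" if "x \<in> {0..1}" for x
      using nonres_exists[OF that] by auto
    have op: "\<forall>\<^sub>F y in at x within {0..1}. nonres y a \<and> nonres y (- a)"
      if "x \<in> {0..1}" "a \<in> {0<..<pi / 2}" "nonres x a \<and> nonres x (- a)" for x a
      using that by (intro eventually_conj eventually_nonres) auto
    obtain \<alpha> \<delta> where \<delta>: "0 < \<delta>" and \<alpha>: "\<And>x. x \<in> {0..1} \<Longrightarrow> \<alpha> x \<in> {0<..<pi / 2}"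
      and nr: "\<And>x y. x \<in> {0..1} \<Longrightarrow> y \<in> {0..1} \<Longrightarrow> dist x y < \<delta> \<Longrightarrow>
        nonres y (\<alpha> x) \<and> nonres y (- \<alpha> x)"
      by (rule compact_uniform_choice[OF compact_Icc ex op]) (assumption | rule that)+
    obtain m :: nat where m: "1 / \<delta> < m" using reals_Archimedean2 by blast
    have m0: "0 < real m" using m \<delta> by (smt (verit) divide_pos_pos)
    have "maslov_partition L M m (\<lambda>i. real i / m) (\<lambda>i. \<alpha> (real (i - 1) / m))"
      unfolding maslov_partition_def rot_inter_trivial_iff
    proof (intro conjI ballI)
      fix i assume i: "i \<in> {1..m}"
      have "real (i - 1) \<le> real m" using i by auto
      then have x: "real (i - 1) / m \<in> {0..1}" using m0 by simp
      show "real (i - 1) / m < real i / m" using i m0 by (intro divide_strict_right_mono) auto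
      show "0 < \<alpha> (real (i - 1) / m)" "\<alpha> (real (i - 1) / m) < pi / 2"
        using \<alpha>[OF x] by auto
      fix l assume l: "l \<in> {real (i - 1) / m..real i / m}"
      have "real i / m \<le> 1" using i m0 by simp
      moreover have "0 \<le> real (i - 1) / m" by simp
      ultimately have l01: "l \<in> {0..1}" using l unfolding atLeastAtMost_iff by linarith
      have "real i / m = real (i - 1) / m + 1 / m"
        using i by (simp add: add_divide_distrib[symmetric] of_nat_diff)
      then have "dist (real (i - 1) / m) l \<le> 1 / m" using l by (auto simp: dist_real_def)
      also have "1 / m < \<delta>" using m m0 \<delta> by (simp add: field_simps)
      finally have "nonres l (\<alpha> (real (i - 1) / m)) \<and> nonres l (- \<alpha> (real (i - 1) / m))"
        using nr[OF x l01] by blast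
      then show "angle_space (L l) (M l) (\<alpha> (real (i - 1) / m)) = {0}"
        "angle_space (L l) (M l) (- \<alpha> (real (i - 1) / m)) = {0}"
        by (simp_all add: nonres_def)
    qed (use m0 in auto)
    then show ?thesis by (rule that)
  qed
  show ?thesis
    unfolding maslov_index_def
  proof (rule the_equality)
    show "\<exists>m p a. maslov_partition L M m p a \<and> N 1 - N 0 = maslov_sum L M m p a"
      using part sum[OF part] by metis
  qed (use sum in blast)
qed

text \<open>In \<open>jump\<close>, two points near \<open>s\<close> are compared with each other
  and not with \<open>s\<close>. Passing an exceptional point then costs \<open>n\<close> in total,
  whereas adding a bound for each side would give \<open>2 n\<close>.\<close>

lemma finite_jumps_bound:
  fixes f :: "real \<Rightarrow> int" and n :: nat
  assumes "finite T" "a \<le> b"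
    and const: "\<And>s. s \<in> {a..b} \<Longrightarrow> s \<notin> T \<Longrightarrow> \<forall>\<^sub>F y in at s within {a..b}. f y = f s"
    and jump: "\<And>s. s \<in> {a..b} \<Longrightarrow>
      \<exists>d>0. \<forall>y\<in>{a..b}. \<forall>z\<in>{a..b}. \<bar>y - s\<bar> < d \<longrightarrow> \<bar>z - s\<bar> < d \<longrightarrow> \<bar>f y - f z\<bar> \<le> int n"
  shows "\<bar>f b - f a\<bar> \<le> int (n * card T)"
  using assms
proof (induction T arbitrary: a b rule: finite_psubset_induct)
  case (psubset T)
  show ?case
  proof (cases "T \<inter> {a..b} = {}")
    case True
    then have "\<forall>s\<in>{a..b}. \<forall>\<^sub>F y in at s within {a..b}. f s = f y"
      using psubset.prems(2) by (fastforce elim: eventually_mono)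
    from connected_local_const[OF connected_Icc _ _ this, of a b] psubset.prems(1)
    show ?thesis by simp
  next
    case False
    then obtain t where t: "t \<in> T" "t \<in> {a..b}" by blast
    from psubset.prems(3)[OF t(2)] obtain d where d: "d > 0"
      "\<And>y z. y \<in> {a..b} \<Longrightarrow> z \<in> {a..b} \<Longrightarrow> \<bar>y - t\<bar> < d \<Longrightarrow> \<bar>z - t\<bar> < d \<Longrightarrow> \<bar>f y - f z\<bar> \<le> int n"
      by blast
    define a' b' where "a' = max a (t - d / 2)" and "b' = min b (t + d / 2)"
    have ab': "a' \<in> {a..b}" "b' \<in> {a..b}" "\<bar>a' - t\<bar> < d" "\<bar>b' - t\<bar> < d"
      using t(2) d(1) by (auto simp: a'_def b'_def)
    have mid: "\<bar>f b' - f a'\<bar> \<le> int n" using d(2) ab' by blast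
    \<comment> \<open>The induction hypothesis serves the parts left and right of \<open>t\<close>,
      whose exceptional points omit \<open>t\<close> and so form proper subsets of
      \<open>T\<close>.\<close>
    have sub: "\<bar>f y - f x\<bar> \<le> int (n * card F)"
      if xy: "a \<le> x" "x \<le> y" "y \<le> b" and F: "F \<subset> T" "T \<inter> {x..y} \<subseteq> F" for x y F
    proof (rule psubset.IH[OF F(1) xy(2)])
      have le: "{x..y} \<subseteq> {a..b}" using xy by auto
      show "\<forall>\<^sub>F z in at s within {x..y}. f z = f s" if "s \<in> {x..y}" "s \<notin> F" for s
        by (rule filter_leD[OF at_le[OF le] psubset.prems(2)]) (use that le F in auto)
      show "\<exists>d>0. \<forall>u\<in>{x..y}. \<forall>z\<in>{x..y}. \<bar>u - s\<bar> < d \<longrightarrow> \<bar>z - s\<bar> < d \<longrightarrow> \<bar>f u - f z\<bar> \<le> int n"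
        if "s \<in> {x..y}" for s
        using psubset.prems(3)[of s] that le by (meson subsetD)
    qed
    have left: "\<bar>f a' - f a\<bar> \<le> int (n * card (T \<inter> {..<t}))"
    proof (cases "a' = a")
      case False
      then have "a' < t" using d(1) by (auto simp: a'_def)
      then show ?thesis using ab' t(1) by (intro sub) auto
    qed simp
    have right: "\<bar>f b - f b'\<bar> \<le> int (n * card (T \<inter> {t<..}))"
    proof (cases "b' = b")
      case False
      then have "t < b'" using d(1) by (auto simp: b'_def)
      then show ?thesis using ab' t(1) by (intro sub) auto
    qed simp
    have "card T = card (insert t ((T \<inter> {..<t}) \<union> (T \<inter> {t<..})))"
      using t(1) by (intro arg_cong[of _ _ card]) auto
    also have "\<dots> = Suc (card ((T \<inter> {..<t}) \<union> (T \<inter> {t<..})))"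
      using psubset.hyps by (intro card_insert_disjoint) auto
    also have "card ((T \<inter> {..<t}) \<union> (T \<inter> {t<..})) = card (T \<inter> {..<t}) + card (T \<inter> {t<..})"
      using psubset.hyps by (intro card_Un_disjoint) auto
    finally have "int (n * card T) = int n + int (n * card (T \<inter> {..<t})) + int (n * card (T \<inter> {t<..}))"
      by (simp add: algebra_simps)
    then show ?thesis using left mid right by linarith
  qed
qed

text \<open>Near any \<open>s\<close> a single label \<open>c\<close> works, so
  \<open>N y - N z\<close> is a difference of two counts. Both lie between 0 and \<open>n\<close>;
  hence the jump bound.\<close>

lemma maslov_potential_crossings:
  fixes L M :: "real \<Rightarrow> (real ^ ('n::finite + 'n)) set"
  assumes "closed_family {0..1} L" "closed_family {0..1} M" and N: "maslov_potential {0..1} L M N"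
    and T: "finite T" "\<And>l. l \<in> {0..1} \<Longrightarrow> L l \<inter> M l \<noteq> {0} \<Longrightarrow> l \<in> T"
  shows "\<bar>N 1 - N 0\<bar> \<le> int (CARD('n) * card T)"
proof (rule finite_jumps_bound[OF T(1)])
  interpret lagrangian_families "{0..1}" L M by standard (rule assms)+
  have ev: "\<exists>c. 0 < c \<and> c < pi \<and> nonres s c \<and>
      (\<forall>\<^sub>F y in at s within {0..1}. N y - count y c = N s - count s c)" if s: "s \<in> {0..1}" for s
  proof -
    obtain c where c: "0 < c" "c < pi" "nonres s c"
      using nonres_exists[OF s] pi_gt_zero by fastforce
    then have "\<forall>\<^sub>F y in at s within {0..1}. N y - count y c = N s - count s c"
      using N s unfolding maslov_potential_def count_def nonres_def by blast
    then show ?thesis using c by blast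
  qed
  show "\<forall>\<^sub>F y in at s within {0..1}. N y = N s" if s: "s \<in> {0..1}" "s \<notin> T" for s
  proof -
    have "nonres s 0"
      using T(2)[OF s(1)] s(2) by (auto simp: nonres_def angle_space_def Int_def)
    obtain c where c: "0 < c" "c < pi" "nonres s c"
      and e: "\<forall>\<^sub>F y in at s within {0..1}. N y - count y c = N s - count s c"
      using ev[OF s(1)] by blast
    from e eventually_count_const[OF s(1) c(3,1,2) \<open>nonres s 0\<close>] show ?thesis
      by eventually_elim simp
  qed
  show "\<exists>d>0. \<forall>y\<in>{0..1}. \<forall>z\<in>{0..1}. \<bar>y - s\<bar> < d \<longrightarrow> \<bar>z - s\<bar> < d \<longrightarrow> \<bar>N y - N z\<bar> \<le> int CARD('n)"
    if s: "s \<in> {0..1}" for s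
  proof -
    obtain c where c: "0 < c" "c < pi"
      and e: "\<forall>\<^sub>F y in at s within {0..1}. N y - count y c = N s - count s c"
      using ev[OF s] by blast
    obtain d where d: "d > 0"
      "\<And>y. y \<in> {0..1} \<Longrightarrow> y \<noteq> s \<Longrightarrow> dist y s < d \<Longrightarrow> N y - count y c = N s - count s c"
      using e unfolding eventually_at by blast
    have "N y - count y c = N s - count s c" if "y \<in> {0..1}" "\<bar>y - s\<bar> < d" for y
      using d(2)[of y] that by (cases "y = s") (auto simp: dist_real_def)
    moreover have "0 \<le> count y c" "count y c \<le> int CARD('n)" if "y \<in> {0..1}" for y
      using count_bounds[OF that c] by auto
    ultimately have "\<bar>N y - N z\<bar> \<le> int CARD('n)"
      if "y \<in> {0..1}" "z \<in> {0..1}" "\<bar>y - s\<bar> < d" "\<bar>z - s\<bar> < d" for y z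
      using that by (smt (verit))
    then show ?thesis using d(1) by blast
  qed
qed simp

subsection \<open>Transporting the index along the flow\<close>

text \<open>The coordinate \<open>\<phi>\<close> is the auxiliary rotation, 0 for the actual
  problem. Making it a parameter lets one potential on a convex set cover the perturbed paths as
  well.\<close>

definition flow_image ::
  "(real \<Rightarrow> real \<Rightarrow> (real ^ ('n::finite + 'n)) \<Rightarrow>\<^sub>L (real ^ ('n + 'n))) \<Rightarrow> (real \<Rightarrow> (real ^ ('n + 'n)) set) \<Rightarrow>
   real \<times> real \<times> real \<Rightarrow> (real ^ ('n + 'n)) set" where
  "flow_image \<Psi> L = (\<lambda>(l, t, \<phi>). (\<lambda>v. rot \<phi> (\<Psi> l t v)) ` L l)"

abbreviation unit_cube :: "(real \<times> real \<times> real) set" where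
  "unit_cube \<equiv> {0..1} \<times> {0..1} \<times> {0..1}"

lemma closed_family_flow_image:
  fixes \<Psi> :: "real \<Rightarrow> real \<Rightarrow> (real ^ ('n::finite + 'n)) \<Rightarrow>\<^sub>L (real ^ ('n + 'n))"
  assumes L: "closed_family {0..1} L"
    and \<Psi>: "continuous_on ({0..1} \<times> {0..1}) (\<lambda>(l, t). \<Psi> l t)"
      "\<And>l t. l \<in> {0..1} \<Longrightarrow> t \<in> {0..1} \<Longrightarrow> symplectic (\<Psi> l t)"
  shows "closed_family unit_cube (flow_image \<Psi> L)"
proof -
  have "closed_family unit_cube (\<lambda>x. L (fst x))"
    by (rule closed_family_compose[OF L]) (auto intro!: continuous_intros)
  then have "closed_family unit_cube
      (\<lambda>x. (\<lambda>v. rot (snd (snd x)) (\<Psi> (fst x) (fst (snd x)) v)) ` L (fst x))"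
  proof (rule closed_family_symplectic_image)
    fix x :: "real \<times> real \<times> real" assume x: "x \<in> unit_cube"
    then have "symplectic (\<Psi> (fst x) (fst (snd x)))" using \<Psi>(2) by auto
    then show "symplectic (\<lambda>v. rot (snd (snd x)) (\<Psi> (fst x) (fst (snd x)) v))"
      using linear_compose[OF _ linear_rot] by (auto simp: symplectic_def J_rot comp_def)
    fix \<xi> and v :: "nat \<Rightarrow> real ^ ('n + 'n)" and w
    assume \<xi>: "\<And>k. \<xi> k \<in> unit_cube" "\<xi> \<longlonglongrightarrow> x" and v: "v \<longlonglongrightarrow> w"
    have "continuous_on unit_cube (\<lambda>x. (\<lambda>(l, t). \<Psi> l t) (fst x, fst (snd x)))"
      by (rule continuous_on_compose2[OF \<Psi>(1)]) (auto intro!: continuous_intros)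
    then have "(\<lambda>k. \<Psi> (fst (\<xi> k)) (fst (snd (\<xi> k)))) \<longlonglongrightarrow> \<Psi> (fst x) (fst (snd x))"
      using continuous_on_tendsto_compose[OF _ \<xi>(2) x] \<xi>(1) by fastforce
    then show "(\<lambda>k. rot (snd (snd (\<xi> k))) (\<Psi> (fst (\<xi> k)) (fst (snd (\<xi> k))) (v k)))
        \<longlonglongrightarrow> rot (snd (snd x)) (\<Psi> (fst x) (fst (snd x)) w)"
      by (intro tendsto_rot tendsto_snd \<xi>(2) bounded_bilinear.tendsto[OF bounded_bilinear_blinfun_apply] v)
  qed
  then show ?thesis by (simp add: flow_image_def case_prod_beta')
qed

text \<open>The extra rotation by \<open>\<epsilon> s\<close> makes the path strictly positive; letting \<open>\<epsilon> \<rightarrow> 0\<close> costs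
  nothing because the potential is upper semicontinuous.\<close>

lemma maslov_potential_flow_mono:
  fixes \<Psi> :: "real \<Rightarrow> real \<Rightarrow> (real ^ ('n::finite + 'n)) \<Rightarrow>\<^sub>L (real ^ ('n + 'n))"
  assumes F: "closed_family unit_cube (flow_image \<Psi> L)" and M: "closed_family {0..1} M"
    and N: "maslov_potential unit_cube (flow_image \<Psi> L) (\<lambda>x. M (fst x)) N"
    and flow: "\<And>t v. t \<in> {0..1} \<Longrightarrow>
      ((\<lambda>t. \<Psi> l t v) has_vector_derivative J (A t *v \<Psi> l t v)) (at t within {0..1})"
    and l: "l \<in> {0..1}" and c: "c \<in> {0..1}" "c + \<sigma> \<in> {0..1}"
    and pos: "\<And>t v. t \<in> {0..1} \<Longrightarrow> 0 \<le> \<sigma> * ((A t *v v) \<bullet> v)"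
  shows "N (l, c, 0) \<le> N (l, c + \<sigma>, 0)"
proof -
  \<comment> \<open>The signed speed \<open>\<sigma>\<close> covers both directions of time, so one
    argument handles both signs of the matrices.\<close>
  define \<tau> where "\<tau> s = c + s * \<sigma>" for s
  have \<tau>: "\<tau> s \<in> {0..1}" if "s \<in> {0..1}" for s
  proof -
    have "\<tau> s = (1 - s) *\<^sub>R c + s *\<^sub>R (c + \<sigma>)" by (simp add: \<tau>_def algebra_simps)
    then show ?thesis
      using convexD_alt[OF convex_real_interval(5) c, of s] that by simp
  qed
  have le: "N (l, c, 0) \<le> N (l, c + \<sigma>, \<epsilon>)" if \<epsilon>: "0 < \<epsilon>" "\<epsilon> \<le> 1" for \<epsilon>
  proof -
    define g where "g s = (l, \<tau> s, \<epsilon> * s)" for s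
    have gc: "continuous_on {0..1} g"
      unfolding g_def \<tau>_def by (intro continuous_intros)
    have gi: "g ` {0..1} \<subseteq> unit_cube"
    proof (rule image_subsetI)
      fix s assume s: "s \<in> {0..1::real}"
      then have "\<epsilon> * s \<in> {0..1}" using \<epsilon> by (simp add: mult_le_one)
      then show "g s \<in> unit_cube" unfolding g_def using l \<tau>[OF s] by blast
    qed
    have "N (g 0) \<le> N (g 1)"
    proof (rule maslov_potential_mono[of 0 1 "\<lambda>s. flow_image \<Psi> L (g s)" "M l" "\<lambda>s. N (g s)"])
      show "closed_family {0..1} (\<lambda>s. flow_image \<Psi> L (g s))"
        by (rule closed_family_compose[OF F gc gi])
      show "lagrangian (M l)" using closed_family_lagrangian[OF M l] .
      show "maslov_potential {0..1} (\<lambda>s. flow_image \<Psi> L (g s)) (\<lambda>_. M l) (\<lambda>s. N (g s))"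
        using maslov_potential_compose[OF N gc gi] by (simp add: g_def)
      fix s u assume s: "s \<in> {0..1::real}" and u: "u \<in> flow_image \<Psi> L (g s)" "u \<noteq> 0"
      then obtain v where v: "v \<in> L l" "u = rot (\<epsilon> * s) (\<Psi> l (\<tau> s) v)"
        by (auto simp: flow_image_def g_def)
      define w where "w y = rot (\<epsilon> * y) (\<Psi> l (\<tau> y) v)" for y
      define z where "z = \<Psi> l (\<tau> s) v"
      \<comment> \<open>The first summand is the velocity of the rotation and contributes
        \<open>\<epsilon> * (u \<bullet> u)\<close> to \<open>J u \<bullet> w'\<close>; the second
        is the velocity of the flow.\<close>
      define w' where "w' = \<epsilon> *\<^sub>R J u + \<sigma> *\<^sub>R rot (\<epsilon> * s) (J (A (\<tau> s) *v z))"
      have dz: "((\<lambda>y. \<Psi> l (\<tau> y) v) has_vector_derivative \<sigma> *\<^sub>R J (A (\<tau> s) *v z)) (at s within {s..1})"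
      proof -
        have "(\<tau> has_vector_derivative \<sigma>) (at s within {s..1})"
          unfolding \<tau>_def by (auto intro!: derivative_eq_intros)
        moreover have "((\<lambda>t. \<Psi> l t v) has_vector_derivative J (A (\<tau> s) *v z)) (at (\<tau> s) within \<tau> ` {s..1})"
          unfolding z_def
        proof (rule has_vector_derivative_within_subset[OF flow[OF \<tau>[OF s]] image_subsetI])
          show "\<tau> y \<in> {0..1}" if "y \<in> {s..1}" for y
            by (rule \<tau>) (use s that in auto)
        qed
        ultimately show ?thesis
          using vector_diff_chain_within[of \<tau> \<sigma> s "{s..1}" "\<lambda>t. \<Psi> l t v"] by (simp add: comp_def)
      qed
      have dw: "(w has_vector_derivative w') (at s within {s..1})"
      proof -
        have "((\<lambda>y. cos (\<epsilon> * y)) has_vector_derivative - sin (\<epsilon> * s) * \<epsilon>) (at s within {s..1})"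
          "((\<lambda>y. sin (\<epsilon> * y)) has_vector_derivative cos (\<epsilon> * s) * \<epsilon>) (at s within {s..1})"
          by (auto intro!: derivative_eq_intros simp flip: has_real_derivative_iff_has_vector_derivative)
        note d = this
        have "((\<lambda>y. cos (\<epsilon> * y) *\<^sub>R \<Psi> l (\<tau> y) v + sin (\<epsilon> * y) *\<^sub>R J (\<Psi> l (\<tau> y) v)) has_vector_derivative
            (cos (\<epsilon> * s) *\<^sub>R (\<sigma> *\<^sub>R J (A (\<tau> s) *v z)) + (- sin (\<epsilon> * s) * \<epsilon>) *\<^sub>R \<Psi> l (\<tau> s) v) +
            (sin (\<epsilon> * s) *\<^sub>R J (\<sigma> *\<^sub>R J (A (\<tau> s) *v z)) + (cos (\<epsilon> * s) * \<epsilon>) *\<^sub>R J (\<Psi> l (\<tau> s) v)))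
            (at s within {s..1})"
          by (intro has_vector_derivative_add bounded_bilinear.has_vector_derivative[OF bounded_bilinear_scaleR]
              d dz bounded_linear.has_vector_derivative[OF matrix_vector_mul_bounded_linear])
        then show ?thesis
          unfolding w_def rot_def w'_def v(2) z_def[symmetric] by (simp add: algebra_simps)
      qed
      have "J u \<bullet> w' = \<epsilon> * (u \<bullet> u) + \<sigma> * ((A (\<tau> s) *v z) \<bullet> z)"
        by (simp add: w'_def inner_add_right v(2) J_rot inner_commute z_def flip: J_rot)
      moreover have "0 < \<epsilon> * (u \<bullet> u)" using u(2) \<epsilon> by simp
      ultimately have "J u \<bullet> w' > 0" using pos[OF \<tau>[OF s], of z] by linarith
      moreover have "w s = u" by (simp add: w_def v)
      moreover have "\<forall>y\<in>{s..1}. w y \<in> flow_image \<Psi> L (g y)"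
        using v(1) by (auto simp: w_def flow_image_def g_def)
      ultimately show "\<exists>w w'. w s = u \<and> (w has_vector_derivative w') (at s within {s..1}) \<and>
          (\<forall>y\<in>{s..1}. w y \<in> flow_image \<Psi> L (g y)) \<and> J u \<bullet> w' > 0"
        using dw by blast
    qed simp
    then show ?thesis by (simp add: g_def \<tau>_def)
  qed
  let ?g = "\<lambda>\<phi>::real. (l, c + \<sigma>, \<phi>)"
  have gc: "continuous_on {0..1} ?g" and gi: "?g ` {0..1} \<subseteq> unit_cube"
    using l c by (auto intro!: continuous_intros)
  have "closed_family {0..1} (\<lambda>\<phi>. M (fst (?g \<phi>)))"
    using closed_family_const[OF closed_family_lagrangian[OF M l]] by simp
  from maslov_potential_eventually_le[OF closed_family_compose[OF F gc gi] this
      maslov_potential_compose[OF N gc gi], of 0]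
  obtain d where "d > 0" "\<And>\<phi>. \<phi> \<in> {0..1} \<Longrightarrow> \<phi> \<noteq> 0 \<Longrightarrow> dist \<phi> 0 < d \<Longrightarrow> N (?g \<phi>) \<le> N (?g 0)"
    unfolding eventually_at by auto
  then have "N (?g (min 1 (d / 2))) \<le> N (?g 0)" by auto
  then show ?thesis using le[of "min 1 (d / 2)"] \<open>d > 0\<close> by simp
qed

text \<open>In the first case \<open>N\<close> rises with \<open>t\<close> at \<open>l = 1\<close>
  and falls at \<open>l = 0\<close>; both changes enlarge the positive increment. In the second case
  both are reversed and lower a negative one.\<close>

lemma abs_maslov_index_le_crossings:
  fixes S :: "real \<Rightarrow> real \<Rightarrow> real ^ ('n::finite + 'n) ^ ('n + 'n)"
    and L1 L2 :: "real \<Rightarrow> (real ^ ('n + 'n)) set"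
  assumes S: "continuous_on ({0..1} \<times> {0..1}) (\<lambda>(l, t). S l t)"
    and sym: "\<And>l t. l \<in> {0..1} \<Longrightarrow> t \<in> {0..1} \<Longrightarrow> transpose (S l t) = S l t"
    and paths: "lagrangian_path L1" "lagrangian_path L2"
    and sign: "(maslov_index L1 L2 > 0 \<and> nonpos_family (S 0) \<and> nonneg_family (S 1)) \<or>
         (maslov_index L1 L2 < 0 \<and> nonneg_family (S 0) \<and> nonpos_family (S 1))"
    and T: "finite T"
      "\<And>l. l \<in> {0..1} \<Longrightarrow> has_nontrivial_solution (S l) (L1 l) (L2 l) \<Longrightarrow> l \<in> T"
  shows "\<bar>maslov_index L1 L2\<bar> \<le> int (CARD('n) * card T)"
proof -
  have L: "closed_family {0..1} L1" and M: "closed_family {0..1} L2"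
    using paths lagrangian_path_closed_family by blast+
  obtain \<Psi> :: "real \<Rightarrow> real \<Rightarrow> (real ^ ('n + 'n)) \<Rightarrow>\<^sub>L (real ^ ('n + 'n))"
    where \<Psi>: "continuous_on ({0..1} \<times> {0..1}) (\<lambda>(l, t). \<Psi> l t)"
      "\<And>l. l \<in> {0..1} \<Longrightarrow> \<Psi> l 0 = id_blinfun"
      "\<And>l t u. l \<in> {0..1} \<Longrightarrow> t \<in> {0..1} \<Longrightarrow>
        ((\<lambda>t. \<Psi> l t u) has_vector_derivative J (S l t *v \<Psi> l t u)) (at t within {0..1})"
      "\<And>l t. l \<in> {0..1} \<Longrightarrow> t \<in> {0..1} \<Longrightarrow> symplectic (\<Psi> l t)"
    by (rule hamiltonian_flow[OF S sym]) (assumption | rule that)+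
  have F: "closed_family unit_cube (flow_image \<Psi> L1)"
    by (rule closed_family_flow_image[OF L \<Psi>(1,4)])
  have F2: "closed_family unit_cube (\<lambda>x. L2 (fst x))"
    by (rule closed_family_compose[OF M]) (auto intro!: continuous_intros)
  have "unit_cube \<noteq> {}" by simp
  then obtain N where N: "maslov_potential unit_cube (flow_image \<Psi> L1) (\<lambda>x. L2 (fst x)) N"
    using maslov_potential_exists[OF F F2] by (metis compact_Icc compact_Times convex_Times convex_real_interval(5))
  have side: "continuous_on {0..1} (\<lambda>l. (l, t, 0))" "(\<lambda>l. (l, t, 0)) ` {0..1} \<subseteq> unit_cube"
    if "t \<in> {0..1}" for t :: real
    using that by (auto intro!: continuous_intros)
  have t01: "0 \<in> {0..1::real}" "1 \<in> {0..1::real}" by auto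
  note F' = closed_family_compose[OF F side] and N' = maslov_potential_compose[OF N side]
  have mas: "maslov_index L1 L2 = N (1, 0, 0) - N (0, 0, 0)"
  proof -
    \<comment> \<open>The identity holds only for \<open>l\<close> in \<open>{0..1}\<close>, so the
      potential property is transferred inside the filter.\<close>
    have eq: "flow_image \<Psi> L1 (l, 0, 0) = L1 l" if "l \<in> {0..1}" for l
      using \<Psi>(2)[OF that] by (simp add: flow_image_def)
    have "maslov_potential {0..1} L1 L2 (\<lambda>l. N (l, 0, 0))"
      unfolding maslov_potential_def
    proof (intro ballI allI impI)
      fix l a assume l: "l \<in> {0..1::real}" and a: "0 < a" "a < pi" "angle_space (L1 l) (L2 l) a = {0}"
      then have "\<forall>\<^sub>F y in at l within {0..1}.
          N (y, 0, 0) - int (maslov_count (flow_image \<Psi> L1 (y, 0, 0)) (L2 y) a) =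
          N (l, 0, 0) - int (maslov_count (flow_image \<Psi> L1 (l, 0, 0)) (L2 l) a)"
        using bspec[OF N'[OF t01(1) t01(1), unfolded maslov_potential_def] l] eq[OF l] by simp
      moreover have "\<forall>\<^sub>F y in at l within {0..1}. y \<in> {0..1}"
        by (simp add: eventually_at_filter)
      ultimately show "\<forall>\<^sub>F y in at l within {0..1}.
          N (y, 0, 0) - int (maslov_count (L1 y) (L2 y) a) =
          N (l, 0, 0) - int (maslov_count (L1 l) (L2 l) a)"
        by eventually_elim (simp only: eq l)
    qed
    then show ?thesis by (rule maslov_index_eq_potential[OF L M])
  qed
  have cross: "\<bar>N (1, 1, 0) - N (0, 1, 0)\<bar> \<le> int (CARD('n) * card T)"
  proof (rule maslov_potential_crossings[OF F'[OF t01(2) t01(2)] M _ T(1), of "\<lambda>l. N (l, 1, 0)"])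
    show "maslov_potential {0..1} (\<lambda>l. flow_image \<Psi> L1 (l, 1, 0)) L2 (\<lambda>l. N (l, 1, 0))"
      using N'[OF t01(2) t01(2)] by simp
    fix l assume l: "l \<in> {0..1::real}" and ne: "flow_image \<Psi> L1 (l, 1, 0) \<inter> L2 l \<noteq> {0}"
    \<comment> \<open>As 0 lies in both spaces, an intersection different from \<open>{0}\<close>
      contains a nonzero vector.\<close>
    have "0 \<in> flow_image \<Psi> L1 (l, 1, 0)" "0 \<in> L2 l"
      using closed_family_lagrangian[OF F, of "(l, 1, 0)"] closed_family_lagrangian[OF M l] l
      by (auto intro!: subspace_0 lagrangian_subspace)
    with ne obtain v where v: "v \<in> L1 l" "\<Psi> l 1 v \<in> L2 l" "\<Psi> l 1 v \<noteq> 0"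
      by (auto simp: flow_image_def)
    have "bvp_solution (S l) (L1 l) (L2 l) (\<lambda>t. \<Psi> l t v)"
      unfolding bvp_solution_def using v \<Psi>(2,3)[OF l]
      by (intro conjI exI[of _ "\<lambda>t. J (S l t *v \<Psi> l t v)"]) auto
    then have "has_nontrivial_solution (S l) (L1 l) (L2 l)"
      unfolding has_nontrivial_solution_def using v(3) t01(2) by blast
    then show "l \<in> T" by (rule T(2)[OF l])
  qed
  have up: "N (l, 0, 0) \<le> N (l, 1, 0)" if "l \<in> {0..1}" "nonneg_family (S l)" for l
    using maslov_potential_flow_mono[OF F M N \<Psi>(3)[OF that(1)] that(1), of 0 1] that(2)
    by (simp add: nonneg_family_def)
  \<comment> \<open>For a nonpositive family the flow is run backwards, from \<open>t = 1\<close>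
    with speed \<open>-1\<close>.\<close>
  have down: "N (l, 1, 0) \<le> N (l, 0, 0)" if "l \<in> {0..1}" "nonpos_family (S l)" for l
    using maslov_potential_flow_mono[OF F M N \<Psi>(3)[OF that(1)] that(1), of 1 "-1"] that(2)
    by (simp add: nonpos_family_def)
  from sign show ?thesis
  proof (elim disjE conjE)
    assume "maslov_index L1 L2 > 0" "nonpos_family (S 0)" "nonneg_family (S 1)"
    then show ?thesis using cross mas up[OF t01(2)] down[OF t01(1)] by linarith
  next
    assume "maslov_index L1 L2 < 0" "nonneg_family (S 0)" "nonpos_family (S 1)"
    then show ?thesis using cross mas up[OF t01(1)] down[OF t01(2)] by linarith
  qed
qed

text \<open>The bound is expressed by a finite subset \<open>T\<close> because \<open>card\<close>
  of an infinite set is 0.\<close>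

theorem theorem3p10:
  fixes S :: "real \<Rightarrow> real \<Rightarrow> real ^ ('n::finite + 'n) ^ ('n + 'n)"
    and L1 L2 :: "real \<Rightarrow> (real ^ ('n + 'n)) set"
  assumes "continuous_on ({0..1} \<times> {0..1}) (\<lambda>(l, t). S l t)"
    and "\<And>l t. l \<in> {0..1} \<Longrightarrow> t \<in> {0..1} \<Longrightarrow> transpose (S l t) = S l t"
    and "lagrangian_path L1" and "lagrangian_path L2"
    and "(maslov_index L1 L2 > 0 \<and> nonpos_family (S 0) \<and> nonneg_family (S 1)) \<or>
         (maslov_index L1 L2 < 0 \<and> nonneg_family (S 0) \<and> nonpos_family (S 1))"
  shows "\<exists>T. finite T \<and>
             T \<subseteq> {l \<in> {0..1}. has_nontrivial_solution (S l) (L1 l) (L2 l)} \<and>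
             int (card T) \<ge> \<lceil>real_of_int \<bar>maslov_index L1 L2\<bar> / real CARD('n)\<rceil>"
proof -
  let ?C = "{l \<in> {0..1}. has_nontrivial_solution (S l) (L1 l) (L2 l)}"
  let ?m = "\<lceil>real_of_int \<bar>maslov_index L1 L2\<bar> / real CARD('n)\<rceil>"
  show ?thesis
  proof (cases "finite ?C")
    case True
    have "\<bar>maslov_index L1 L2\<bar> \<le> int (CARD('n) * card ?C)"
      by (rule abs_maslov_index_le_crossings[OF assms True]) auto
    then have "real_of_int \<bar>maslov_index L1 L2\<bar> \<le> real_of_int (int (CARD('n) * card ?C))"
      by (simp only: of_int_le_iff)
    then have "real_of_int \<bar>maslov_index L1 L2\<bar> / real CARD('n) \<le> real (card ?C)"
      by (simp add: pos_divide_le_eq mult.commute)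
    then have "?m \<le> int (card ?C)" by (simp add: ceiling_le_iff)
    then show ?thesis using True by blast
  next
    \<comment> \<open>Infinitely many crossings contain finite subsets of every size.\<close>
    case False
    from infinite_arbitrarily_large[OF this, of "nat ?m"] obtain T where
      "finite T" "card T = nat ?m" "T \<subseteq> ?C" by blast
    then show ?thesis by (intro exI[of _ T]) auto
  qed
qed

end
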